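(* Let $F\in\mathcal{L}^d$, and assume that $F$ is analytic in a neighborhood of infinity, that is, the function $(z^1,\dots,z^d)\mapsto F(1/z^1,\dots,1/z^d)$ extends to be analytic on a neighborhood of the origin. Then for all sufficiently small real $t$, with at most countably many exceptions, the function $F_t$ has the following representation. There exist a Hilbert space $\mathcal{M}$, a densely defined self-adjoint operator $X$ on $\mathcal{M}$, a vector $v\in\mathcal{M}$, a real constant $C$, and $d$ orthogonal projections $P^1,\dots,P^d$ on $\mathcal{M}$ with $\sum_{r=1}^dP^r=I_{\mathcal{M}}$, such that $$F_t(z)=C+\Big\langle\Big(X-\sum_{r=1}^dz^rP^r\Big)^{-1}v,v\Big\rangle\qquad\text{for } z\in\Pi^d.$$
   Context: $\Pi=\{z\in\mathbb{C}:\operatorname{Im}z>0\}$; superscripts denote coordinates, $z=(z^1,\dots,z^d)$. The Löwner class $\mathcal{L}^d$ is the set of functions $F:\Pi^d\to\overline{\Pi}$ for which there exist $d$ positive semi-definite kernels $A^1,\dots,A^d$ on $\Pi^d$ such that $F(z)-\overline{F(w)}=\sum_{r=1}^d(z^r-\overline{w^r})A^r(z,w)$ for all $z,w\in\Pi^d$. (A positive semi-definite kernel on a set is a complex-valued function $A$ of two variables in the set such that for every finite set of distinct points $z_1,\dots,z_N$ the matrix $[A(z_j,z_i)]$ is positive semi-definite.) For real $t$, $\rho_t(z)=\dfrac{z+t}{1-tz}$, and for $F\in\mathcal{L}^d$, $$F_t(z^1,\dots,z^d)=\rho_t\big(F(\rho_t(z^1),\dots,\rho_t(z^d))\big).$$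
   Formalization: F is extended to the lower half-planes by reflection and the analytic extension near the origin must agree with both halves, so it is real at real points; as stated the claim fails for the constant F = i, which equals F_t for every t while the right side tends to the real C. *)

theory Defs
  imports "HOL-Analysis.Analysis" "HOL-Library.Function_Algebras"
begin

definition upper_half_plane :: "complex set" where
  "upper_half_plane = {z. Im z > 0}"

definition poly_half_plane :: "(complex ^ 'd) set" where
  "poly_half_plane = {z. \<forall>r. z $ r \<in> upper_half_plane}"

text \<open>The matrix with entries \<open>M i j = A (z j) (z i)\<close> is positive semi-definite iff the sum of
  \<open>cnj (c i) * M i j * c j\<close> is real and nonnegative for all \<open>c\<close>. Finite families of distinct
  points are represented as finite subsets of \<open>S\<close>.\<close>

definition psd_kernel :: "'a set \<Rightarrow> ('a \<Rightarrow> 'a \<Rightarrow> complex) \<Rightarrow> bool" where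
  "psd_kernel S A \<longleftrightarrow>
     (\<forall>T c. finite T \<and> T \<subseteq> S \<longrightarrow>
        (\<Sum>x\<in>T. \<Sum>y\<in>T. cnj (c x) * A y x * c y) \<in> \<real>\<^sub>\<ge>\<^sub>0)"

text \<open>Only the values on \<^const>\<open>poly_half_plane\<close> matter; elsewhere a member of the class is
  arbitrary.\<close>

definition loewner_class :: "(complex ^ 'd \<Rightarrow> complex) set" where
  "loewner_class = {F.
     (\<forall>z\<in>poly_half_plane. F z \<in> closure upper_half_plane) \<and>
     (\<exists>A :: 'd \<Rightarrow> complex ^ 'd \<Rightarrow> complex ^ 'd \<Rightarrow> complex.
        (\<forall>r. psd_kernel poly_half_plane (A r)) \<and>
        (\<forall>z\<in>poly_half_plane. \<forall>w\<in>poly_half_plane.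
           F z - cnj (F w) = (\<Sum>r\<in>UNIV. (z $ r - cnj (w $ r)) * A r z w)))}"

definition rho :: "real \<Rightarrow> complex \<Rightarrow> complex" where
  "rho t z = (z + of_real t) / (1 - of_real t * z)"

definition conj_rho :: "real \<Rightarrow> (complex ^ 'd \<Rightarrow> complex) \<Rightarrow> complex ^ 'd \<Rightarrow> complex" where
  "conj_rho t F z = rho t (F (\<chi> r. rho t (z $ r)))"

text \<open>Analyticity of a function of several complex variables on an open set: the Frechet derivative
  exists at every point and is complex linear.\<close>

definition several_analytic_on :: "(complex ^ 'd \<Rightarrow> complex) \<Rightarrow> (complex ^ 'd) set \<Rightarrow> bool"
    (infixl \<open>several'_analytic'_on\<close> 50) where
  "G several_analytic_on U \<longleftrightarrow> open U \<and>
     (\<forall>z\<in>U. \<exists>D. Vector_Spaces.linear (*s) (*) D \<and> (G has_derivative D) (at z))"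

definition vec_cnj :: "complex ^ 'd \<Rightarrow> complex ^ 'd" where
  "vec_cnj z = (\<chi> r. cnj (z $ r))"

definition vec_inverse :: "complex ^ 'd \<Rightarrow> complex ^ 'd" where
  "vec_inverse z = (\<chi> r. 1 / z $ r)"

text \<open>As usual for Pick functions, a function \<open>F\<close> on the poly-upper half-plane is regarded as
  extended to the poly-lower half-plane by the reflection \<open>F (vec_cnj z) = cnj (F z)\<close>, and
  the analytic function near the origin has to extend both halves. This makes the
  extension real at real points. A constant function with the value \<open>\<i>\<close>, which belongs to
  the class and whose restriction to the upper half continues analytically,
  is thereby not analytic at infinity. Note that \<open>1 / 0 = 0\<close> is in neither half-plane.\<close>

definition analytic_at_infinity :: "(complex ^ 'd \<Rightarrow> complex) \<Rightarrow> bool" where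
  "analytic_at_infinity F \<longleftrightarrow>
     (\<exists>U G. 0 \<in> U \<and> G several_analytic_on U \<and>
        (\<forall>z\<in>U. vec_inverse z \<in> poly_half_plane \<longrightarrow> G z = F (vec_inverse z)) \<and>
        (\<forall>z\<in>U. vec_cnj (vec_inverse z) \<in> poly_half_plane \<longrightarrow>
           G z = cnj (F (vec_cnj (vec_inverse z)))))"

text \<open>A complex Hilbert space is carried by a subspace \<open>H\<close> of an ambient complex vector space
  (which is a type). The inner product is linear in the first argument, and is
  unconstrained outside \<open>H\<close>.\<close>

locale complex_hilbert_space =
  vector_space scale for scale :: "complex \<Rightarrow> 'a::ab_group_add \<Rightarrow> 'a" +
  fixes H :: "'a set" and ip :: "'a \<Rightarrow> 'a \<Rightarrow> complex"
  assumes subspace_carrier: "subspace H"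
    and ip_add_left: "\<lbrakk>x \<in> H; y \<in> H; z \<in> H\<rbrakk> \<Longrightarrow> ip (x + y) z = ip x z + ip y z"
    and ip_scale_left: "\<lbrakk>x \<in> H; y \<in> H\<rbrakk> \<Longrightarrow> ip (scale c x) y = c * ip x y"
    and ip_commute: "\<lbrakk>x \<in> H; y \<in> H\<rbrakk> \<Longrightarrow> ip y x = cnj (ip x y)"
    and ip_nonneg: "x \<in> H \<Longrightarrow> 0 \<le> Re (ip x x)"
    and ip_definite: "\<lbrakk>x \<in> H; ip x x = 0\<rbrakk> \<Longrightarrow> x = 0"
    and complete:
      "\<lbrakk>\<And>n. s n \<in> H;
        \<And>e. e > 0 \<Longrightarrow> \<exists>N::nat. \<forall>m\<ge>N. \<forall>n\<ge>N. sqrt (Re (ip (s m - s n) (s m - s n))) < e\<rbrakk>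
       \<Longrightarrow> \<exists>l\<in>H. (\<lambda>n. sqrt (Re (ip (s n - l) (s n - l)))) \<longlonglongrightarrow> 0"
begin

text \<open>\<open>T\<close> is a linear map from the subspace \<open>D\<close> of \<open>H\<close> to \<open>H\<close>.\<close>

definition linear_operator :: "'a set \<Rightarrow> ('a \<Rightarrow> 'a) \<Rightarrow> bool" where
  "linear_operator D T \<longleftrightarrow> subspace D \<and> D \<subseteq> H \<and> T ` D \<subseteq> H \<and>
     (\<forall>x\<in>D. \<forall>y\<in>D. T (x + y) = T x + T y) \<and> (\<forall>c. \<forall>x\<in>D. T (scale c x) = scale c (T x))"

definition dense_in_carrier :: "'a set \<Rightarrow> bool" where
  "dense_in_carrier D \<longleftrightarrow> D \<subseteq> H \<and>
     (\<forall>x\<in>H. \<forall>e>0. \<exists>y\<in>D. sqrt (Re (ip (x - y) (x - y))) < e)"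

definition adjoint_graph :: "'a set \<Rightarrow> ('a \<Rightarrow> 'a) \<Rightarrow> ('a \<times> 'a) set" where
  "adjoint_graph D T = {(y, w). y \<in> H \<and> w \<in> H \<and> (\<forall>x\<in>D. ip (T x) y = ip x w)}"

definition self_adjoint :: "'a set \<Rightarrow> ('a \<Rightarrow> 'a) \<Rightarrow> bool" where
  "self_adjoint D T \<longleftrightarrow> linear_operator D T \<and> dense_in_carrier D \<and>
     adjoint_graph D T = (\<lambda>x. (x, T x)) ` D"

definition orthogonal_projection :: "('a \<Rightarrow> 'a) \<Rightarrow> bool" where
  "orthogonal_projection P \<longleftrightarrow> linear_operator H P \<and>
     (\<forall>x\<in>H. P (P x) = P x) \<and> (\<forall>x\<in>H. \<forall>y\<in>H. ip (P x) y = ip x (P y))"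

end

text \<open>Since HOL cannot quantify existentially over types, the Hilbert space is taken inside the type
  \<^typ>\<open>nat \<Rightarrow> complex\<close>, with an arbitrary inner product. Every Hilbert space with
  a countable dense subset has an isomorphic copy there, and this is no restriction here: the closed
  subspace generated from \<open>v\<close> by the projections and the resolvents of \<open>X\<close> is
  separable and reduces all of them. Invertibility of \<open>X - (\<Sum>r. z r P r)\<close>, as a map from the
  domain \<open>D\<close> of \<open>X\<close> onto \<open>H\<close>, is part of the assertion.\<close>

definition has_resolvent_representation :: "(complex ^ 'd \<Rightarrow> complex) \<Rightarrow> bool" where
  "has_resolvent_representation f \<longleftrightarrow>
     (\<exists>(scale :: complex \<Rightarrow> (nat \<Rightarrow> complex) \<Rightarrow> (nat \<Rightarrow> complex)) H ip D X v (C :: real) P.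
        complex_hilbert_space scale H ip \<and>
        complex_hilbert_space.self_adjoint scale H ip D X \<and>
        v \<in> H \<and>
        (\<forall>r. complex_hilbert_space.orthogonal_projection scale H ip (P r)) \<and>
        (\<forall>x\<in>H. (\<Sum>r\<in>UNIV. P r x) = x) \<and>
        (\<forall>z\<in>poly_half_plane.
           let T = (\<lambda>x. X x - (\<Sum>r\<in>UNIV. scale (z $ r) (P r x)))
           in bij_betw T D H \<and> f z = of_real C + ip (inv_into D T v) v))"

end

theory Submission
  imports Defs
begin

text \<open>Restricted to a countable dense set of points, the Loewner kernels factor through vectors
  \<open>u z\<close>, and the defining identity says that the pairs \<open>((1, u z), (- F z, z u z))\<close> are isotropic for
  the form \<open>\<langle>y, x'\<rangle> - \<langle>x, y'\<rangle>\<close>: they span a symmetric relation on \<open>\<complex> \<oplus> M\<close>. Let \<open>T\<close> be a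
  self-adjoint relation extending it on a larger space. Replacing \<open>F\<close> by \<open>conj_rho t F\<close>
  amounts to the rotation \<open>(x, y) \<mapsto> (x + t y, y - t x)\<close> of \<open>T\<close>. Analyticity
  at infinity makes \<open>u z\<close> converge as \<open>z\<close> tends vertically to the diagonal point \<open>- 1 / t\<close>, so the
  rotated relation contains a pair \<open>((1, 0), (- C, - v))\<close>; compressing it to \<open>M\<close> then gives a
  self-adjoint relation \<open>X\<close> with \<open>(X - z) u = v\<close> and \<open>F_t(z) = C + \<langle>u, v\<rangle>\<close>. It is an operator unless
  \<open>- 1 / t\<close> is an eigenvalue of \<open>T\<close>, and by separability there are only countably many
  eigenvalues.\<close>

text \<open>The map \<open>rho t\<close> carries infinity to -1/t, so the behaviour of F_t at
  infinity is that of F near a real diagonal point. There analyticity and reflection give a real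
  value and a finite vertical derivative. This derivative is the limit of all Gram entries of the
  vectors \<open>u z\<close>, which is why they converge. Relations replace operators because the
  span of the pairs need be neither a graph nor densely defined. The restriction to countably many
  points secures separability, which is used twice: to count eigenvalues, and to copy the space into
  \<open>nat \<Rightarrow> complex\<close>. The points left out are recovered because a self-adjoint
  relation is closed and \<open>u z\<close> depends on z in a locally Lipschitz way. Separability is
  phrased as a countable set with trivial orthogonal complement: this passes to products at once and
  serves both uses directly.\<close>

section \<open>Separable complex Hilbert spaces\<close>

text \<open>The complex structure is multiplication by the imaginary unit on a real Hilbert space.\<close>

class separable_hilbert = real_inner + complete_space +
  fixes imul :: "'a \<Rightarrow> 'a"
  assumes imul_add: "imul (x + y) = imul x + imul y"
    and imul_scaleR: "imul (r *\<^sub>R x) = r *\<^sub>R imul x"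
    and inner_imul_imul: "inner (imul x) (imul y) = inner x y"
    and imul_imul: "imul (imul x) = - x"
    and countable_total: "\<exists>E. countable E \<and> (\<forall>x. (\<forall>e\<in>E. inner x e = 0) \<longrightarrow> x = 0)"

instantiation complex :: separable_hilbert
begin
definition imul_complex :: "complex \<Rightarrow> complex" where "imul_complex z = \<i> * z"
instance
proof
  show "\<exists>E. countable E \<and> (\<forall>x::complex. (\<forall>e\<in>E. inner x e = 0) \<longrightarrow> x = 0)"
  proof (intro exI[of _ "{1, \<i>}"] conjI allI impI)
    fix x :: complex
    assume "\<forall>e\<in>{1, \<i>}. inner x e = 0"
    then have "inner x 1 = 0" "inner x \<i> = 0" by blast+
    then show "x = 0" by (simp add: inner_complex_def complex_eq_iff)
  qed auto
qed (auto simp: imul_complex_def inner_complex_def algebra_simps)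
end

instantiation prod :: (separable_hilbert, separable_hilbert) separable_hilbert
begin
definition imul_prod :: "'a \<times> 'b \<Rightarrow> 'a \<times> 'b" where
  "imul_prod p = (imul (fst p), imul (snd p))"
instance
proof
  obtain E1 :: "'a set" where 1: "countable E1" "\<And>x. (\<forall>e\<in>E1. inner x e = 0) \<Longrightarrow> x = 0"
    using countable_total by blast
  obtain E2 :: "'b set" where 2: "countable E2" "\<And>x. (\<forall>e\<in>E2. inner x e = 0) \<Longrightarrow> x = 0"
    using countable_total by blast
  show "\<exists>E. countable E \<and> (\<forall>x::'a \<times> 'b. (\<forall>e\<in>E. inner x e = 0) \<longrightarrow> x = 0)"
  proof (intro exI[of _ "(\<lambda>e. (e, 0)) ` E1 \<union> (\<lambda>e. (0, e)) ` E2"] conjI allI impI)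
    fix x :: "'a \<times> 'b"
    assume "\<forall>e\<in>(\<lambda>e. (e, 0)) ` E1 \<union> (\<lambda>e. (0, e)) ` E2. inner x e = 0"
    then have "\<forall>e\<in>E1. inner (fst x) e = 0" "\<forall>e\<in>E2. inner (snd x) e = 0"
      by (auto simp: inner_prod_def ball_Un)
    then show "x = 0" using 1 2 by (simp add: prod_eq_iff)
  qed (use 1 2 in auto)
qed (auto simp: imul_prod_def inner_prod_def imul_add imul_scaleR imul_imul inner_imul_imul)
end

instantiation vec :: (separable_hilbert, finite) separable_hilbert
begin
definition imul_vec :: "'a ^ 'b \<Rightarrow> 'a ^ 'b" where "imul_vec x = (\<chi> i. imul (x $ i))"
instance
proof
  obtain E :: "'a set" where E: "countable E" "\<And>x. (\<forall>e\<in>E. inner x e = 0) \<Longrightarrow> x = 0"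
    using countable_total by blast
  show "\<exists>E. countable E \<and> (\<forall>x::'a ^ 'b. (\<forall>e\<in>E. inner x e = 0) \<longrightarrow> x = 0)"
  proof (intro exI[of _ "\<Union>i. axis i ` E"] conjI allI impI)
    fix x :: "'a ^ 'b"
    assume "\<forall>e\<in>(\<Union>i. axis i ` E). inner x e = 0"
    then have "\<forall>e\<in>E. inner (x $ i) e = 0" for i
      by (auto simp: inner_axis)
    then show "x = 0" using E by (simp add: vec_eq_iff)
  qed (use E in auto)
qed (auto simp: imul_vec_def inner_vec_def imul_add imul_scaleR imul_imul inner_imul_imul vec_eq_iff)
end

section \<open>Square-summable sequences\<close>

text \<open>A type of its own, so that products and powers inherit completeness and separability
  through class instances. The passage to a carrier inside \<open>nat \<Rightarrow> complex\<close>
  is made once, in \<open>has_resolvent_representationI\<close>.\<close>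

typedef l2 = "{f :: nat \<Rightarrow> complex. summable (\<lambda>n. (cmod (f n))\<^sup>2)}"
  morphisms coeff Abs_l2
  by (rule exI[of _ "\<lambda>_. 0"]) simp

lemma summable_coeff: "summable (\<lambda>n. (cmod (coeff x n))\<^sup>2)"
  using coeff[of x] by simp

lemma coeff_Abs: "summable (\<lambda>n. (cmod (f n))\<^sup>2) \<Longrightarrow> coeff (Abs_l2 f) = f"
  by (simp add: Abs_l2_inverse)

lemma l2_eqI: "(\<And>n. coeff x n = coeff y n) \<Longrightarrow> x = y"
  by (metis coeff_inject ext)

lemma square_summable_add:
  fixes f g :: "nat \<Rightarrow> complex"
  assumes "summable (\<lambda>n. (cmod (f n))\<^sup>2)" "summable (\<lambda>n. (cmod (g n))\<^sup>2)"
  shows "summable (\<lambda>n. (cmod (f n + g n))\<^sup>2)"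
proof (rule summable_comparison_test')
  show "summable (\<lambda>n. 2 * (cmod (f n))\<^sup>2 + 2 * (cmod (g n))\<^sup>2)"
    using assms by (intro summable_add summable_mult)
  show "norm ((cmod (f n + g n))\<^sup>2) \<le> 2 * (cmod (f n))\<^sup>2 + 2 * (cmod (g n))\<^sup>2" if "n \<ge> 0" for n
  proof -
    have "(cmod (f n + g n))\<^sup>2 \<le> (cmod (f n) + cmod (g n))\<^sup>2"
      by (simp add: norm_triangle_ineq power_mono)
    also have "\<dots> \<le> 2 * (cmod (f n))\<^sup>2 + 2 * (cmod (g n))\<^sup>2"
      using zero_le_power2[of "cmod (f n) - cmod (g n)"]
      by (simp add: power2_sum power2_diff)
    finally show ?thesis by simp
  qed
qed

lemma square_summable_mult:
  fixes f :: "nat \<Rightarrow> complex"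
  shows "summable (\<lambda>n. (cmod (f n))\<^sup>2) \<Longrightarrow> summable (\<lambda>n. (cmod (c * f n))\<^sup>2)"
  by (simp add: norm_mult power_mult_distrib summable_mult)

lemma summable_inner_coeff: "summable (\<lambda>n. inner (coeff x n) (coeff y n))"
proof (rule summable_comparison_test')
  show "summable (\<lambda>n. (cmod (coeff x n))\<^sup>2 + (cmod (coeff y n))\<^sup>2)"
    by (intro summable_add summable_coeff)
  show "norm (inner (coeff x n) (coeff y n)) \<le> (cmod (coeff x n))\<^sup>2 + (cmod (coeff y n))\<^sup>2"
    if "n \<ge> 0" for n
  proof -
    have "\<bar>inner (coeff x n) (coeff y n)\<bar> \<le> cmod (coeff x n) * cmod (coeff y n)"
      by (rule Cauchy_Schwarz_ineq2)
    also have "\<dots> \<le> (cmod (coeff x n))\<^sup>2 + (cmod (coeff y n))\<^sup>2"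
    proof -
      have "2 * cmod (coeff x n) * cmod (coeff y n) \<le> (cmod (coeff x n))\<^sup>2 + (cmod (coeff y n))\<^sup>2"
        by (rule sum_squares_bound)
      moreover have "0 \<le> cmod (coeff x n) * cmod (coeff y n)" by simp
      ultimately show ?thesis by linarith
    qed
    finally show ?thesis by simp
  qed
qed

instantiation l2 :: real_inner
begin
definition "0 = Abs_l2 (\<lambda>_. 0)"
definition "x + y = Abs_l2 (\<lambda>n. coeff x n + coeff y n)"
definition "- x = Abs_l2 (\<lambda>n. - coeff x n)"
definition "x - y = Abs_l2 (\<lambda>n. coeff x n - coeff y n)"
definition "r *\<^sub>R x = Abs_l2 (\<lambda>n. r *\<^sub>R coeff x n)"
definition "inner x y = (\<Sum>n. inner (coeff x n) (coeff y n))"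
definition "norm (x::l2) = sqrt (inner x x)"
definition "dist (x::l2) y = norm (x - y)"
definition "sgn (x::l2) = inverse (norm x) *\<^sub>R x"
definition uniformity_l2 :: "(l2 \<times> l2) filter" where
  "uniformity = (INF e\<in>{0 <..}. principal {(x, y::l2). dist x y < e})"
definition open_l2 :: "l2 set \<Rightarrow> bool" where
  "open (U::l2 set) \<longleftrightarrow> (\<forall>x\<in>U. \<forall>\<^sub>F (x', y) in uniformity. x' = x \<longrightarrow> y \<in> U)"

lemma coeff_zero [simp]: "coeff 0 n = 0"
  by (simp add: zero_l2_def coeff_Abs)
lemma coeff_add [simp]: "coeff (x + y) n = coeff x n + coeff y n"
  by (simp add: plus_l2_def coeff_Abs square_summable_add summable_coeff)
lemma coeff_minus [simp]: "coeff (- x) n = - coeff x n"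
  by (simp add: uminus_l2_def coeff_Abs summable_coeff)
lemma coeff_diff [simp]: "coeff (x - y) n = coeff x n - coeff y n"
  using square_summable_add[OF summable_coeff[of x] summable_coeff[of "- y"]]
  by (simp add: minus_l2_def coeff_Abs)
lemma coeff_scaleR [simp]: "coeff (r *\<^sub>R x) n = r *\<^sub>R coeff x n"
  using square_summable_mult[OF summable_coeff[of x], of "of_real r"]
  by (simp add: scaleR_l2_def coeff_Abs scaleR_conv_of_real)

instance
proof
  fix x y z :: l2 and r s :: real
  show "inner x y = inner y x"
    by (simp add: inner_l2_def inner_commute)
  show "inner (x + y) z = inner x z + inner y z"
    by (simp add: inner_l2_def inner_add_left suminf_add summable_inner_coeff)
  show "inner (r *\<^sub>R x) y = r * inner x y"
    by (simp add: inner_l2_def suminf_mult summable_inner_coeff)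
  show "0 \<le> inner x x"
    by (simp add: inner_l2_def suminf_nonneg summable_inner_coeff)
  show "inner x x = 0 \<longleftrightarrow> x = 0"
  proof
    assume "inner x x = 0"
    then have "\<forall>n. inner (coeff x n) (coeff x n) = 0"
      using suminf_eq_zero_iff[OF summable_inner_coeff[of x x]] by (simp add: inner_l2_def)
    then show "x = 0" by (intro l2_eqI) simp
  qed (simp add: inner_l2_def)
qed (rule norm_l2_def dist_l2_def sgn_l2_def uniformity_l2_def open_l2_def
  | rule l2_eqI, simp add: algebra_simps)+
end

lemma norm_l2_eq: "(norm x)\<^sup>2 = (\<Sum>n. (cmod (coeff x n))\<^sup>2)"
proof -
  have "(norm x)\<^sup>2 = inner x x" by (rule power2_norm_eq_inner)
  then show ?thesis unfolding inner_l2_def by (simp add: dot_square_norm)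
qed

lemma sum_coeff_le: "(\<Sum>n<N. (cmod (coeff x n))\<^sup>2) \<le> (norm x)\<^sup>2"
  unfolding norm_l2_eq by (rule sum_le_suminf) (auto simp: summable_coeff)

lemma cmod_coeff_le: "cmod (coeff x n) \<le> norm x"
proof -
  have "(cmod (coeff x n))\<^sup>2 \<le> (\<Sum>k<Suc n. (cmod (coeff x k))\<^sup>2)"
    by (rule member_le_sum) auto
  also have "\<dots> \<le> (norm x)\<^sup>2" by (rule sum_coeff_le)
  finally show ?thesis by (simp add: power2_le_iff_abs_le)
qed

instance l2 :: complete_space
proof
  fix X :: "nat \<Rightarrow> l2"
  assume X: "Cauchy X"
  have "Cauchy (\<lambda>m. coeff (X m) n)" for n
  proof (rule metric_CauchyI)
    fix e :: real assume "e > 0"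
    then obtain M where "\<forall>m\<ge>M. \<forall>k\<ge>M. dist (X m) (X k) < e"
      using X by (meson metric_CauchyD)
    moreover have "dist (coeff (X m) n) (coeff (X k) n) \<le> dist (X m) (X k)" for m k
      using cmod_coeff_le[of "X m - X k" n] by (simp add: dist_norm)
    ultimately show "\<exists>M. \<forall>m\<ge>M. \<forall>k\<ge>M. dist (coeff (X m) n) (coeff (X k) n) < e"
      by (meson le_less_trans)
  qed
  then have "\<exists>a. (\<lambda>m. coeff (X m) n) \<longlonglongrightarrow> a" for n
    unfolding Cauchy_convergent_iff convergent_def .
  then obtain l where l: "\<And>n. (\<lambda>m. coeff (X m) n) \<longlonglongrightarrow> l n"
    by metis
  \<comment> \<open>Fatou: a bound on all partial sums of the differences passes to the coordinatewise limit.\<close>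
  have fatou: "\<exists>M. \<forall>m\<ge>M. \<forall>N. (\<Sum>n<N. (cmod (coeff (X m) n - l n))\<^sup>2) \<le> e\<^sup>2" if "e > 0" for e
  proof -
    obtain M where M: "\<forall>m\<ge>M. \<forall>k\<ge>M. dist (X m) (X k) < e"
      using X \<open>e > 0\<close> by (meson metric_CauchyD)
    have "(\<Sum>n<N. (cmod (coeff (X m) n - l n))\<^sup>2) \<le> e\<^sup>2" if "m \<ge> M" for m N
    proof (rule tendsto_upperbound)
      show "(\<lambda>k. \<Sum>n<N. (cmod (coeff (X m) n - coeff (X k) n))\<^sup>2)
          \<longlonglongrightarrow> (\<Sum>n<N. (cmod (coeff (X m) n - l n))\<^sup>2)"
        by (intro tendsto_intros l)
      show "\<forall>\<^sub>F k in sequentially. (\<Sum>n<N. (cmod (coeff (X m) n - coeff (X k) n))\<^sup>2) \<le> e\<^sup>2"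
      proof (rule eventually_sequentiallyI)
        fix k assume "k \<ge> M"
        have "(\<Sum>n<N. (cmod (coeff (X m) n - coeff (X k) n))\<^sup>2) \<le> (norm (X m - X k))\<^sup>2"
          using sum_coeff_le[where x = "X m - X k" and N = N] by simp
        also have "\<dots> \<le> e\<^sup>2"
          using M \<open>m \<ge> M\<close> \<open>k \<ge> M\<close> by (intro power_mono) (auto simp: dist_norm less_imp_le)
        finally show "(\<Sum>n<N. (cmod (coeff (X m) n - coeff (X k) n))\<^sup>2) \<le> e\<^sup>2" .
      qed
    qed simp
    then show ?thesis by blast
  qed
  have sm: "summable (\<lambda>n. (cmod (l n))\<^sup>2)"
  proof -
    obtain m where m: "\<And>N. (\<Sum>n<N. (cmod (coeff (X m) n - l n))\<^sup>2) \<le> 1"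
      using fatou[of 1] by auto
    have "summable (\<lambda>n. (cmod (coeff (X m) n - l n))\<^sup>2)"
      by (rule bounded_imp_summable[of _ 1]) (simp_all only: m lessThan_Suc_atMost[symmetric] zero_le_power2)
    from square_summable_add[OF summable_coeff[of "X m"] square_summable_mult[OF this, of "-1"]]
    show ?thesis by simp
  qed
  have "X \<longlonglongrightarrow> Abs_l2 l"
  proof (rule metric_LIMSEQ_I)
    fix e :: real assume "e > 0"
    then obtain M where M: "\<forall>m\<ge>M. \<forall>N. (\<Sum>n<N. (cmod (coeff (X m) n - l n))\<^sup>2) \<le> (e/2)\<^sup>2"
      using fatou[of "e/2"] by auto
    have "dist (X m) (Abs_l2 l) < e" if "m \<ge> M" for m
    proof -
      have "(norm (X m - Abs_l2 l))\<^sup>2 \<le> (e/2)\<^sup>2"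
        unfolding norm_l2_eq
        by (rule suminf_le_const)
          (use summable_coeff[of "X m - Abs_l2 l"] M that in \<open>auto simp: coeff_Abs[OF sm]\<close>)
      then have "norm (X m - Abs_l2 l) \<le> e/2"
        using \<open>e > 0\<close> by (simp add: power2_le_iff_abs_le)
      then show ?thesis using \<open>e > 0\<close> by (simp add: dist_norm)
    qed
    then show "\<exists>M. \<forall>m\<ge>M. dist (X m) (Abs_l2 l) < e" by blast
  qed
  then show "convergent X" by (auto simp: convergent_def)
qed

lemma inner_l2_single:
  "summable (\<lambda>n. (cmod ((if n = k then c else 0) :: complex))\<^sup>2)"
  "inner x (Abs_l2 (\<lambda>n. if n = k then c else 0)) = inner (coeff x k) c"
proof -
  show s: "summable (\<lambda>n. (cmod ((if n = k then c else 0) :: complex))\<^sup>2)"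
    by (rule summable_finite[of "{k}"]) auto
  have "(\<Sum>n. inner (coeff x n) (if n = k then c else 0))
      = (\<Sum>n\<in>{k}. inner (coeff x n) (if n = k then c else 0))"
    by (rule suminf_finite) auto
  then show "inner x (Abs_l2 (\<lambda>n. if n = k then c else 0)) = inner (coeff x k) c"
    by (simp add: inner_l2_def coeff_Abs[OF s])
qed

instantiation l2 :: separable_hilbert
begin
definition "imul x = Abs_l2 (\<lambda>n. \<i> * coeff x n)"

lemma coeff_imul [simp]: "coeff (imul x) n = \<i> * coeff x n"
  unfolding imul_l2_def by (subst coeff_Abs) (auto intro!: square_summable_mult summable_coeff)

instance
proof
  show "\<exists>E. countable E \<and> (\<forall>x::l2. (\<forall>e\<in>E. inner x e = 0) \<longrightarrow> x = 0)"
  proof (intro exI[of _ "(\<lambda>(k, c). Abs_l2 (\<lambda>n. if n = k then c else 0)) ` (UNIV \<times> {1, \<i>})"]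
      conjI allI impI)
    fix x :: l2
    assume *: "\<forall>e\<in>(\<lambda>(k, c). Abs_l2 (\<lambda>n. if n = k then c else 0)) ` (UNIV \<times> {1, \<i>}). inner x e = 0"
    have "inner (coeff x k) c = 0" if "c \<in> {1, \<i>}" for k c
      using * that inner_l2_single(2)[of x k c] by auto
    from this[of 1] this[of \<i>] show "x = 0"
      by (intro l2_eqI) (simp add: inner_complex_def complex_eq_iff)
  qed auto
  show "inner (imul x) (imul y) = inner x y" for x y :: l2
    by (simp add: inner_l2_def inner_complex_def algebra_simps)
qed (auto intro!: l2_eqI simp: algebra_simps)
end

section \<open>The complex inner product\<close>

lemma inner_imul_left: "inner (imul x) y = - inner x (imul (y :: 'a::separable_hilbert))"
  using inner_imul_imul[of x "imul y"] by (simp add: imul_imul)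

lemma inner_imul_self [simp]: "inner x (imul (x :: 'a::separable_hilbert)) = 0"
  using inner_imul_left[of x x] by (simp add: inner_commute)

lemma imul_simps [simp]:
  fixes x y :: "'a::separable_hilbert"
  shows "imul (0 :: 'a) = 0" "imul (- x) = - imul x" "imul (x - y) = imul x - imul y"
    "imul (imul x) = - x" "norm (imul x) = norm x"
proof -
  show 0: "imul (0 :: 'a) = 0" using imul_scaleR[of 0 "0::'a"] by simp
  show 1: "imul (- x) = - imul x" for x :: 'a using imul_scaleR[of "-1" x] by simp
  show "imul (x - y) = imul x - imul y" using imul_add[of x "- y"] 1 by simp
  show "imul (imul x) = - x" by (rule imul_imul)
  show "norm (imul x) = norm x" by (simp add: norm_eq_sqrt_inner inner_imul_imul)
qed

lemma bounded_linear_imul: "bounded_linear (imul :: 'a::separable_hilbert \<Rightarrow> 'a)"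
  by (rule bounded_linear_intro[of _ 1]) (auto simp: imul_add imul_scaleR)

lemmas tendsto_imul [tendsto_intros] = bounded_linear.tendsto[OF bounded_linear_imul]

definition cscale :: "complex \<Rightarrow> 'a::separable_hilbert \<Rightarrow> 'a" where
  "cscale c x = Re c *\<^sub>R x + Im c *\<^sub>R imul x"

text \<open>The real inner product is the real part, so norms and limits are those of the real
  space. Having \<open>imul\<close> on the second argument makes the form linear in the
  first.\<close>

definition cip :: "'a::separable_hilbert \<Rightarrow> 'a \<Rightarrow> complex" where
  "cip x y = Complex (inner x y) (inner x (imul y))"

lemma cscale_simps [simp]:
  fixes x :: "'a::separable_hilbert"
  shows "cscale 0 x = 0" "cscale 1 x = x" "cscale (of_real r) x = r *\<^sub>R x" "cscale c (0::'a) = 0"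
    "cscale \<i> x = imul x" "cscale c (- x) = - cscale c x" "cscale (- c) x = - cscale c x"
  by (auto simp: cscale_def)

lemma cscale_add_right: "cscale c (x + y) = cscale c x + cscale c y"
  and cscale_add_left: "cscale (c + d) x = cscale c x + cscale d x"
  and cscale_diff_right: "cscale c (x - y) = cscale c x - cscale c y"
  and cscale_diff_left: "cscale (c - d) x = cscale c x - cscale d x"
  and cscale_cscale: "cscale c (cscale d x) = cscale (c * d) x"
  by (auto simp: cscale_def imul_add imul_scaleR algebra_simps scaleR_left_diff_distrib)

lemma cscale_sum_right: "cscale c (sum f A) = (\<Sum>a\<in>A. cscale c (f a))"
  by (induction A rule: infinite_finite_induct) (auto simp: cscale_add_right)

lemma cip_add_left: "cip (x + y) z = cip x z + cip y z"
  and cip_add_right: "cip x (y + z) = cip x y + cip x z"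
  and cip_diff_left: "cip (x - y) z = cip x z - cip y z"
  and cip_diff_right: "cip x (y - z) = cip x y - cip x z"
  and cip_scaleR_left: "cip (r *\<^sub>R x) y = r * cip x y"
  and cip_scaleR_right: "cip x (r *\<^sub>R y) = r * cip x y"
  and cip_imul_left: "cip (imul x) y = \<i> * cip x y"
  and cip_imul_right: "cip x (imul y) = - \<i> * cip x y"
  by (auto simp: cip_def complex_eq_iff inner_add_left inner_add_right inner_diff_left
      inner_diff_right imul_add imul_scaleR inner_imul_left)

lemma cip_simps [simp]: "cip 0 x = 0" "cip x 0 = 0" "cip (- x) y = - cip x y" "cip x (- y) = - cip x y"
  by (auto simp: cip_def complex_eq_iff)

lemma cip_commute: "cip y x = cnj (cip x y)"
  using inner_imul_left[of x y]
  by (simp add: cip_def complex_eq_iff inner_commute[of x y] inner_commute[of "imul x" y])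

text \<open>The projection theorem below speaks of real orthogonality; for sets stable under
  \<open>imul\<close> this turns it into complex orthogonality.\<close>

lemma cip_eq_0I: "inner w x = 0 \<Longrightarrow> inner w (imul x) = 0 \<Longrightarrow> cip x w = 0"
  by (subst cip_commute) (simp add: cip_def complex_eq_iff)

lemma cip_cscale_left: "cip (cscale c x) y = c * cip x y"
  by (simp add: cscale_def cip_add_left cip_scaleR_left cip_imul_left complex_eq_iff)

lemma cip_cscale_right: "cip x (cscale c y) = cnj c * cip x y"
  by (simp add: cscale_def cip_add_right cip_scaleR_right cip_imul_right complex_eq_iff)

lemma cip_sum_left: "cip (sum f A) y = (\<Sum>a\<in>A. cip (f a) y)"
  by (induction A rule: infinite_finite_induct) (auto simp: cip_add_left)

lemma cip_sum_right: "cip x (sum f A) = (\<Sum>a\<in>A. cip x (f a))"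
  by (induction A rule: infinite_finite_induct) (auto simp: cip_add_right)

lemma cip_self: "cip x x = of_real ((norm x)\<^sup>2)"
  by (simp add: cip_def complex_eq_iff power2_norm_eq_inner)

lemma Re_cip: "Re (cip x y) = inner x y"
  by (simp add: cip_def)

lemma Im_cip: "Im (cip x y) = inner x (imul y)"
  by (simp add: cip_def)

lemma Im_cip_le: "\<bar>Im (cip x y)\<bar> \<le> norm x * norm y"
  using Cauchy_Schwarz_ineq2[of x "imul y"] by (simp add: Im_cip)

lemma tendsto_cip [tendsto_intros]:
  "(f \<longlongrightarrow> a) G \<Longrightarrow> (g \<longlongrightarrow> b) G \<Longrightarrow> ((\<lambda>x. cip (f x) (g x)) \<longlongrightarrow> cip a b) G"
  unfolding cip_def by (intro tendsto_intros)

lemma tendsto_cscale [tendsto_intros]: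
  "(f \<longlongrightarrow> a) G \<Longrightarrow> (g \<longlongrightarrow> b) G \<Longrightarrow> ((\<lambda>x. cscale (f x) (g x)) \<longlongrightarrow> cscale a b) G"
  unfolding cscale_def by (intro tendsto_intros)

lemma norm_cscale: "norm (cscale c x) = cmod c * norm x"
proof -
  have "complex_of_real ((norm (cscale c x))\<^sup>2) = c * cnj c * of_real ((norm x)\<^sup>2)"
    by (simp only: cip_self[symmetric] cip_cscale_left cip_cscale_right) simp
  also have "\<dots> = complex_of_real ((cmod c * norm x)\<^sup>2)"
    by (simp add: complex_norm_square power_mult_distrib del: of_real_power)
  finally have "(norm (cscale c x))\<^sup>2 = (cmod c * norm x)\<^sup>2"
    using of_real_eq_iff by blast
  then show ?thesis by simp
qed

lemma cip_complex [simp]: "cip (a :: complex) b = a * cnj b"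
  by (simp add: cip_def imul_complex_def inner_complex_def complex_eq_iff algebra_simps)

lemma cip_Pair: "cip (a, b) (c, d) = cip a c + cip b d"
  by (simp add: cip_def imul_prod_def complex_eq_iff)

lemma cip_prod: "cip p q = cip (fst p) (fst q) + cip (snd p) (snd q)"
  by (cases p; cases q) (simp add: cip_Pair)

lemma cip_vec: "cip x y = (\<Sum>i\<in>UNIV. cip (x $ i) (y $ i))"
  by (simp add: cip_def imul_vec_def inner_vec_def complex_eq_iff Re_sum Im_sum)

lemma cscale_complex [simp]: "cscale c (a :: complex) = c * a"
  by (simp add: cscale_def imul_complex_def complex_eq_iff)

lemma cscale_Pair: "cscale c (a, b) = (cscale c a, cscale c b)"
  by (simp add: cscale_def imul_prod_def)

lemma fst_cscale [simp]: "fst (cscale c p) = cscale c (fst p)"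
  and snd_cscale [simp]: "snd (cscale c p) = cscale c (snd p)"
  by (simp_all add: cscale_def imul_prod_def)

lemma cscale_vec_nth [simp]: "cscale c x $ i = cscale c (x $ i)"
  by (simp add: cscale_def imul_vec_def)

section \<open>Orthogonality\<close>

text \<open>Nearest-point argument: for p outside L, a minimizing sequence for the distance
  converges to some q in L, and p - q is orthogonal to L.\<close>

lemma orthogonal_vector:
  fixes L :: "'a::{real_inner, complete_space} set"
  assumes L: "subspace L" "closed L" "L \<noteq> UNIV"
  obtains w where "w \<noteq> 0" "\<And>x. x \<in> L \<Longrightarrow> inner w x = 0"
proof -
  obtain p where p: "p \<notin> L" using L by blast
  have ne: "L \<noteq> {}" using subspace_0[OF L(1)] by blast
  define d where "d = infdist p L"
  have d: "d > 0" using L p ne by (simp add: d_def infdist_pos_not_in_closed)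
  have dle: "d \<le> norm (p - y)" if "y \<in> L" for y
    using infdist_le[OF that, of p] by (simp add: d_def dist_norm)
  have "\<exists>y\<in>L. norm (p - y) < d + 1 / Suc n" for n
  proof (rule ccontr)
    assume "\<not> ?thesis"
    then have "d + 1 / Suc n \<le> infdist p L"
      unfolding infdist_notempty[OF ne] by (intro cINF_greatest[OF ne]) (auto simp: dist_norm not_less)
    then show False by (simp add: d_def)
  qed
  then obtain y where y: "\<And>n. y n \<in> L" "\<And>n. norm (p - y n) < d + 1 / Suc n" by metis
  have lim: "(\<lambda>n. norm (p - y n)) \<longlonglongrightarrow> d"
  proof (rule tendsto_sandwich[where f = "\<lambda>_. d" and h = "\<lambda>n. d + 1 / Suc n"])
    show "(\<lambda>n. d + 1 / Suc n) \<longlonglongrightarrow> d"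
      using tendsto_add[OF tendsto_const[of d] LIMSEQ_inverse_real_of_nat]
      by (simp add: inverse_eq_divide)
  qed (use y dle in \<open>auto intro!: always_eventually less_imp_le\<close>)
  \<comment> \<open>Parallelogram law; the midpoint c lies in L, so its distance from p is at least
    d.\<close>
  have par: "(norm (y m - y n))\<^sup>2 \<le> 2 * ((norm (p - y m))\<^sup>2 - d\<^sup>2) + 2 * ((norm (p - y n))\<^sup>2 - d\<^sup>2)"
    for m n
  proof -
    define c where "c = (1/2) *\<^sub>R (y m + y n)"
    have "c \<in> L" using y L(1) by (simp add: c_def subspace_scale subspace_add)
    then have "d\<^sup>2 \<le> (norm (p - c))\<^sup>2"
      using dle d by (intro power_mono) auto
    moreover have "(norm (y m - y n))\<^sup>2 + 4 * (norm (p - c))\<^sup>2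
        = 2 * (norm (p - y m))\<^sup>2 + 2 * (norm (p - y n))\<^sup>2"
      unfolding c_def power2_norm_eq_inner
      by (simp add: inner_diff_left inner_diff_right inner_add_left inner_add_right inner_commute
          field_simps)
    ultimately show ?thesis by simp
  qed
  have "Cauchy y"
  proof (rule metric_CauchyI)
    fix e :: real assume e: "e > 0"
    have "(\<lambda>n. (norm (p - y n))\<^sup>2) \<longlonglongrightarrow> d\<^sup>2"
      by (intro tendsto_power lim)
    then have "\<forall>\<^sub>F n in sequentially. (norm (p - y n))\<^sup>2 < d\<^sup>2 + e\<^sup>2 / 4"
      using e by (intro order_tendstoD) auto
    then obtain M where M: "\<And>n. n \<ge> M \<Longrightarrow> (norm (p - y n))\<^sup>2 < d\<^sup>2 + e\<^sup>2 / 4"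
      by (auto simp: eventually_sequentially)
    have "dist (y m) (y n) < e" if "m \<ge> M" "n \<ge> M" for m n
    proof -
      have "(norm (y m - y n))\<^sup>2 < e\<^sup>2"
        using par[of m n] M[OF that(1)] M[OF that(2)] by simp
      then show ?thesis using e by (simp add: dist_norm power2_less_imp_less)
    qed
    then show "\<exists>M. \<forall>m\<ge>M. \<forall>n\<ge>M. dist (y m) (y n) < e" by blast
  qed
  then obtain q where q: "y \<longlonglongrightarrow> q"
    unfolding Cauchy_convergent_iff convergent_def by blast
  have qL: "q \<in> L" using closed_sequentially[OF L(2)] y q by blast
  have nq: "norm (p - q) = d"
    by (rule LIMSEQ_unique[OF _ lim]) (intro tendsto_intros q)
  show thesis
  proof
    show "p - q \<noteq> 0" using p qL by auto
    show "inner (p - q) x = 0" if x: "x \<in> L" for x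
    proof (rule ccontr)
      assume nz: "inner (p - q) x \<noteq> 0"
      \<comment> \<open>The minimizer of the distance along the line q + a x; it would lower the
        squared distance below d^2.\<close>
      define a where "a = inner (p - q) x / inner x x"
      have x0: "inner x x > 0" using nz by auto
      have "q + a *\<^sub>R x \<in> L" using qL x L(1) by (simp add: subspace_add subspace_scale)
      then have "d\<^sup>2 \<le> (norm (p - q - a *\<^sub>R x))\<^sup>2"
        using dle[of "q + a *\<^sub>R x"] d by (intro power_mono) (auto simp: diff_diff_eq)
      also have "\<dots> = d\<^sup>2 - 2 * a * inner (p - q) x + a\<^sup>2 * inner x x"
        unfolding nq[symmetric] power2_norm_eq_inner
        by (simp add: inner_diff_left inner_diff_right inner_commute power2_eq_square algebra_simps)
      also have "\<dots> = d\<^sup>2 - (inner (p - q) x)\<^sup>2 / inner x x"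
        using x0 by (simp add: a_def power2_eq_square field_simps)
      finally show False using nz x0 by (simp add: field_simps)
    qed
  qed
qed

lemma subspace_closure:
  fixes L :: "'a::real_normed_vector set"
  assumes "subspace L"
  shows "subspace (closure L)"
proof (rule subspaceI)
  show "0 \<in> closure L" using assms closure_subset subspace_0 by blast
next
  fix x y assume "x \<in> closure L" "y \<in> closure L"
  then obtain f g where "\<And>n. f n \<in> L" "f \<longlonglongrightarrow> x" "\<And>n. g n \<in> L" "g \<longlonglongrightarrow> y"
    unfolding closure_sequential by blast
  then show "x + y \<in> closure L"
    unfolding closure_sequential using assms
    by (intro exI[of _ "\<lambda>n. f n + g n"]) (auto intro: tendsto_add subspace_add)
next
  fix c x assume "x \<in> closure L"
  then obtain f where "\<And>n. f n \<in> L" "f \<longlonglongrightarrow> x"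
    unfolding closure_sequential by blast
  then show "c *\<^sub>R x \<in> closure L"
    unfolding closure_sequential using assms
    by (intro exI[of _ "\<lambda>n. c *\<^sub>R f n"]) (auto intro: tendsto_scaleR subspace_scale)
qed

lemma closure_subspace_eq_UNIV:
  fixes L :: "'a::{real_inner, complete_space} set"
  assumes L: "subspace L" and orth: "\<And>w. (\<And>x. x \<in> L \<Longrightarrow> inner w x = 0) \<Longrightarrow> w = 0"
  shows "closure L = UNIV"
proof (rule ccontr)
  assume "closure L \<noteq> UNIV"
  then obtain w where "w \<noteq> 0" "\<And>x. x \<in> closure L \<Longrightarrow> inner w x = 0"
    using orthogonal_vector[of "closure L"] subspace_closure[OF L] by (metis closed_closure)
  then show False using orth[of w] closure_subset by blast
qed

text \<open>Every y i has a nonzero coefficient against some member of the countable total set E,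
  and by Bessel each member of E has nonzero coefficients against only countably many y i.\<close>

lemma countable_orthogonal_family:
  fixes y :: "'i \<Rightarrow> 'a::separable_hilbert"
  assumes nz: "\<And>i. i \<in> I \<Longrightarrow> y i \<noteq> 0"
    and orth: "\<And>i j. i \<in> I \<Longrightarrow> j \<in> I \<Longrightarrow> i \<noteq> j \<Longrightarrow> inner (y i) (y j) = 0"
  shows "countable I"
proof -
  obtain E :: "'a set" where E: "countable E" "\<And>x. (\<forall>e\<in>E. inner x e = 0) \<Longrightarrow> x = 0"
    using countable_total by blast
  define a where "a e i = (inner e (y i))\<^sup>2 / (norm (y i))\<^sup>2" for e i
  have bessel: "sum (a e) J \<le> (norm e)\<^sup>2" if J: "finite J" "J \<subseteq> I" for e J
  proof -
    \<comment> \<open>The orthogonal projection of e onto the span of the y i with i in J; Bessel's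
      inequality is then 0 \<le> |e - s|^2.\<close>
    define s where "s = (\<Sum>i\<in>J. (inner e (y i) / (norm (y i))\<^sup>2) *\<^sub>R y i)"
    have es: "inner e s = sum (a e) J"
      by (simp add: s_def inner_sum_right a_def power2_eq_square)
    have "inner s s = (\<Sum>i\<in>J. \<Sum>j\<in>J. inner ((inner e (y i) / (norm (y i))\<^sup>2) *\<^sub>R y i)
        ((inner e (y j) / (norm (y j))\<^sup>2) *\<^sub>R y j))"
      unfolding s_def inner_sum_left by (simp only: inner_sum_right)
    also have "\<dots> = (\<Sum>i\<in>J. \<Sum>j\<in>J. if j = i then a e i else 0)"
    proof (intro sum.cong refl)
      fix i j assume "i \<in> J" "j \<in> J"
      then show "inner ((inner e (y i) / (norm (y i))\<^sup>2) *\<^sub>R y i)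
        ((inner e (y j) / (norm (y j))\<^sup>2) *\<^sub>R y j) = (if j = i then a e i else 0)"
        using nz[of i] orth[of i j] J
        by (auto simp: a_def dot_square_norm power2_eq_square)
    qed
    also have "\<dots> = sum (a e) J" using J by simp
    finally have ss: "inner s s = sum (a e) J" .
    have "0 \<le> inner (e - s) (e - s)" by simp
    also have "\<dots> = (norm e)\<^sup>2 - sum (a e) J"
      using es ss by (simp add: inner_diff_left inner_diff_right inner_commute power2_norm_eq_inner)
    finally show ?thesis by simp
  qed
  \<comment> \<open>By Bessel at most |e|^2 (n + 1) of the terms can reach 1 / (n + 1).\<close>
  have fin: "finite {i \<in> I. 1 / Suc n \<le> a e i}" for e n
  proof (rule finite_if_finite_subsets_card_bdd[THEN conjunct1])
    fix J assume J: "J \<subseteq> {i \<in> I. 1 / Suc n \<le> a e i}" "finite J"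
    have "card J * (1 / Suc n) \<le> sum (a e) J"
      using J sum_bounded_below[of J "1 / Suc n" "a e"] by auto
    also have "\<dots> \<le> (norm e)\<^sup>2" using J bessel[of J e] by blast
    finally have "card J \<le> (norm e)\<^sup>2 * Suc n" by (simp add: field_simps)
    then show "card J \<le> nat \<lceil>(norm e)\<^sup>2 * Suc n\<rceil>" by linarith
  qed
  have "I \<subseteq> (\<Union>e\<in>E. \<Union>n. {i \<in> I. 1 / Suc n \<le> a e i})"
  proof
    fix i assume i: "i \<in> I"
    then obtain e where e: "e \<in> E" "inner (y i) e \<noteq> 0" using E(2) nz by blast
    then have "a e i > 0" using nz[OF i] by (simp add: a_def inner_commute)
    then obtain n where "inverse (real (Suc n)) < a e i" using reals_Archimedean by blast
    then have "1 / Suc n \<le> a e i" by (simp add: inverse_eq_divide)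
    then show "i \<in> (\<Union>e\<in>E. \<Union>n. {i \<in> I. 1 / Suc n \<le> a e i})" using e i by blast
  qed
  then show ?thesis
    by (rule countable_subset) (intro countable_UN E countableI_type countable_finite fin)
qed

section \<open>Operator pencils\<close>

locale projection_family =
  fixes P :: "'d::finite \<Rightarrow> 'm::separable_hilbert \<Rightarrow> 'm"
  assumes P_add: "P r (x + y) = P r x + P r y"
    and P_cscale: "P r (cscale c x) = cscale c (P r x)"
    and P_idem: "P r (P r x) = P r x"
    and P_sym: "cip (P r x) y = cip x (P r y)"
    and P_sum: "(\<Sum>r\<in>UNIV. P r x) = x"
begin

definition act :: "complex ^ 'd \<Rightarrow> 'm \<Rightarrow> 'm" where
  "act z x = (\<Sum>r\<in>UNIV. cscale (z $ r) (P r x))"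

lemma P_diff: "P r (x - y) = P r x - P r y"
  using P_add[of r "x - y" y] by (simp add: algebra_simps)

lemma act_add: "act z (x + y) = act z x + act z y"
  by (simp add: act_def P_add cscale_add_right sum.distrib)

lemma act_diff: "act z (x - y) = act z x - act z y"
  by (simp add: act_def P_diff cscale_diff_right sum_subtractf)

lemma act_diff_left: "act (z - w) x = act z x - act w x"
  by (simp add: act_def cscale_diff_left sum_subtractf)

lemma act_cscale: "act z (cscale c x) = cscale c (act z x)"
  by (simp add: act_def P_cscale cscale_cscale cscale_sum_right mult.commute)

lemma act_const: "act (\<chi> r. c) x = cscale c x"
  by (simp add: act_def P_sum flip: cscale_sum_right)

lemma cip_act: "cip (act z x) y = (\<Sum>r\<in>UNIV. z $ r * cip (P r x) y)"
  by (simp add: act_def cip_sum_left cip_cscale_left)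

lemma cip_act_right: "cip x (act z y) = (\<Sum>r\<in>UNIV. cnj (z $ r) * cip (P r x) y)"
  by (simp add: act_def cip_sum_right cip_cscale_right P_sym)

lemma cip_act_adjoint: "cip (act z x) y = cip x (act (vec_cnj z) y)"
  by (simp add: cip_act cip_act_right vec_cnj_def)

lemma cip_P_self: "cip (P r x) x = of_real ((norm (P r x))\<^sup>2)"
  by (metis P_idem P_sym cip_self)

lemma norm_P_le: "norm (P r x) \<le> norm x"
proof -
  have "(norm (P r x))\<^sup>2 = inner (P r x) x"
    using arg_cong[OF cip_P_self, of Re r x] by (simp add: Re_cip)
  also have "\<dots> \<le> norm (P r x) * norm x" by (rule norm_cauchy_schwarz)
  finally show ?thesis
    by (cases "P r x = 0") (auto simp: power2_eq_square)
qed

lemma norm_act_le: "norm (act z x) \<le> CARD('d) * norm z * norm x"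
proof -
  have "norm (act z x) \<le> (\<Sum>r\<in>(UNIV :: 'd set). norm z * norm x)"
    unfolding act_def
    by (rule order_trans[OF norm_sum], rule sum_mono)
      (auto intro!: mult_mono simp: norm_cscale norm_P_le Finite_Cartesian_Product.norm_nth_le)
  then show ?thesis by simp
qed

lemma tendsto_act [tendsto_intros]:
  assumes f: "(f \<longlongrightarrow> z) G" and g: "(g \<longlongrightarrow> x) G"
  shows "((\<lambda>t. act (f t) (g t)) \<longlongrightarrow> act z x) G"
proof -
  have "bounded_linear (P r)" for r
    by (rule bounded_linear_intro[of _ 1])
      (use P_cscale[of r "of_real _"] in \<open>auto simp: P_add norm_P_le\<close>)
  then show ?thesis
    unfolding act_def by (intro tendsto_intros f bounded_linear.tendsto[OF _ g])
qed

lemma Im_cip_act: "Im (cip (act z x) x) = (\<Sum>r\<in>UNIV. Im (z $ r) * (norm (P r x))\<^sup>2)"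
  by (simp add: cip_act cip_P_self Im_sum)

lemma norm_sq_eq_sum: "(norm x)\<^sup>2 = (\<Sum>r\<in>UNIV. (norm (P r x))\<^sup>2)"
proof -
  have "cip x x = (\<Sum>r\<in>UNIV. cip (P r x) x)"
    by (simp add: P_sum flip: cip_sum_left)
  then have "complex_of_real ((norm x)\<^sup>2) = of_real (\<Sum>r\<in>UNIV. (norm (P r x))\<^sup>2)"
    by (simp add: cip_self cip_P_self)
  then show ?thesis using of_real_eq_iff by blast
qed

text \<open>The weights |P r x|^2 add up to |x|^2, so the left-hand bound is a weighted comparison
  of the Im (z r) with m. This coercivity gives injectivity of the pencil and the Lipschitz estimate
  for model vectors.\<close>

lemma Im_cip_act_ge:
  assumes "\<And>r. m \<le> Im (z $ r)"
  shows "m * (norm x)\<^sup>2 \<le> Im (cip (act z x) x)"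
  unfolding Im_cip_act norm_sq_eq_sum[of x] sum_distrib_left
  by (intro sum_mono mult_right_mono assms) simp

lemma P_0: "P r 0 = 0"
  using P_diff[of r 0 0] by simp

lemma P_sum_right: "P r (sum g A) = (\<Sum>a\<in>A. P r (g a))"
  by (induction A rule: infinite_finite_induct) (simp_all add: P_add P_0)

text \<open>In the decomposition of |P s x|^2 over all projections the term of index s already uses
  up the whole, so every other term vanishes.\<close>

lemma P_orth:
  assumes "r \<noteq> s"
  shows "P r (P s x) = 0"
proof -
  have "(norm (P r (P s x)))\<^sup>2 + (norm (P s (P s x)))\<^sup>2 = (\<Sum>q\<in>{r, s}. (norm (P q (P s x)))\<^sup>2)"
    using assms by simp
  also have "\<dots> \<le> (norm (P s x))\<^sup>2"
    unfolding norm_sq_eq_sum[of "P s x"] by (rule sum_mono2) auto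
  finally show ?thesis by (simp add: P_idem)
qed

lemma P_act: "P r (act z x) = cscale (z $ r) (P r x)"
proof -
  have "P r (act z x) = (\<Sum>s\<in>UNIV. if s = r then cscale (z $ r) (P r x) else 0)"
    unfolding act_def P_sum_right by (intro sum.cong refl) (simp add: P_cscale P_orth P_idem)
  then show ?thesis by simp
qed

text \<open>Multiplicativity of \<open>act\<close> transfers coordinatewise identities, in
  particular the equation defining \<open>rho\<close>, to operators.\<close>

lemma act_act: "act z (act w x) = act (\<chi> r. z $ r * w $ r) x"
  by (simp add: act_def[of _ "act w x"] act_def[of "\<chi> r. z $ r * w $ r"] P_act cscale_cscale)

lemma act_add_left: "act (z + w) x = act z x + act w x"
  by (simp add: act_def cscale_add_left sum.distrib)

lemma act_0: "act z 0 = 0"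
  using act_diff[of z 0 0] by simp

end

section \<open>Invertibility of self-adjoint pencils and their transfer to spaces of
  sequences\<close>

lemma poly_half_plane_lower_bound:
  fixes z :: "complex ^ 'd::finite"
  assumes "z \<in> poly_half_plane"
  obtains m where "m > 0" "\<And>r. m \<le> Im (z $ r)"
proof
  show "0 < Min (range (\<lambda>r. Im (z $ r)))"
    using assms by (subst Min_gr_iff) (auto simp: poly_half_plane_def upper_half_plane_def)
qed simp

text \<open>\<open>X_adjoint\<close> equates X with its adjoint as a graph. Symmetry, closedness and
  density of D follow: if w is orthogonal to D then (0, w) is in the adjoint graph, so w = X 0 =
  0.\<close>

locale self_adjoint_pencil = projection_family P
  for P :: "'d::finite \<Rightarrow> 'm::separable_hilbert \<Rightarrow> 'm" +
  fixes D :: "'m set" and X :: "'m \<Rightarrow> 'm"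
  assumes D_add: "x \<in> D \<Longrightarrow> y \<in> D \<Longrightarrow> x + y \<in> D"
    and D_cscale: "x \<in> D \<Longrightarrow> cscale c x \<in> D"
    and D_0: "0 \<in> D"
    and X_add: "x \<in> D \<Longrightarrow> y \<in> D \<Longrightarrow> X (x + y) = X x + X y"
    and X_cscale: "x \<in> D \<Longrightarrow> X (cscale c x) = cscale c (X x)"
    and X_adjoint: "(\<forall>x\<in>D. cip (X x) y = cip x w) \<longleftrightarrow> y \<in> D \<and> w = X y"
begin

lemma X_sym: "x \<in> D \<Longrightarrow> y \<in> D \<Longrightarrow> cip (X x) y = cip x (X y)"
  using X_adjoint by blast

lemma D_diff: "x \<in> D \<Longrightarrow> y \<in> D \<Longrightarrow> x - y \<in> D"
  using D_add[OF _ D_cscale[of y "- 1"]] by simp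

lemma X_diff: "x \<in> D \<Longrightarrow> y \<in> D \<Longrightarrow> X (x - y) = X x - X y"
  using X_add[OF _ D_cscale[of y "- 1"]] X_cscale[of y "- 1"] by simp

lemma dense_domain: "closure D = UNIV"
proof (rule closure_subspace_eq_UNIV)
  show "subspace D"
    using D_0 D_add D_cscale[of _ "of_real _"] by (auto intro!: subspaceI)
  fix w assume w: "\<And>x. x \<in> D \<Longrightarrow> inner w x = 0"
  have "cip x w = 0" if "x \<in> D" for x
    using w[OF that] w[OF D_cscale[OF that, of \<i>]] by (intro cip_eq_0I) simp_all
  then have "0 \<in> D \<and> w = X 0" using X_adjoint[of 0 w] by simp
  then show "w = 0" using X_diff[OF D_0 D_0] by simp
qed

lemma X_closed:
  assumes "\<And>n. x n \<in> D" "x \<longlonglongrightarrow> a" "(\<lambda>n. X (x n)) \<longlonglongrightarrow> b"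
  shows "a \<in> D \<and> b = X a"
proof -
  have "cip (X y) a = cip y b" if "y \<in> D" for y
  proof (rule LIMSEQ_unique)
    show "(\<lambda>n. cip (X y) (x n)) \<longlonglongrightarrow> cip (X y) a" by (intro tendsto_intros assms)
    show "(\<lambda>n. cip (X y) (x n)) \<longlonglongrightarrow> cip y b"
      unfolding X_sym[OF that assms(1)] by (intro tendsto_intros assms)
  qed
  then show ?thesis using X_adjoint by blast
qed

text \<open>The lower bound gives injectivity and a closed range. The range is dense because a
  vector w orthogonal to it lies in D with X w = \<open>act (vec_cnj z) w\<close>; then the
  imaginary part of the form of \<open>act z\<close> at w is 0, and coercivity gives w = 0.\<close>

lemma bij_pencil:
  assumes z: "z \<in> poly_half_plane"
  shows "bij_betw (\<lambda>x. X x - act z x) D UNIV"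
proof -
  obtain m where m: "m > 0" "\<And>r. m \<le> Im (z $ r)"
    using poly_half_plane_lower_bound[OF z] by blast
  let ?T = "\<lambda>x. X x - act z x"
  have T_diff: "?T (x - y) = ?T x - ?T y" if "x \<in> D" "y \<in> D" for x y
    using that by (simp add: X_diff act_diff)
  have T_add: "?T (x + y) = ?T x + ?T y" if "x \<in> D" "y \<in> D" for x y
    using that by (simp add: X_add act_add)
  have T_cscale: "?T (cscale c x) = cscale c (?T x)" if "x \<in> D" for c x
    using that by (simp add: X_cscale act_cscale cscale_diff_right)
  \<comment> \<open>By symmetry the form of X at x is real, so the imaginary part comes from
    \<open>act z\<close> alone.\<close>
  have below: "m * norm x \<le> norm (?T x)" if x: "x \<in> D" for x
  proof -
    have "Im (cip (X x) x) = 0"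
      using X_sym[OF x x] cip_commute[of "X x" x] by (auto simp: complex_eq_iff)
    then have "m * (norm x)\<^sup>2 \<le> - Im (cip (?T x) x)"
      using Im_cip_act_ge[OF m(2), of x] by (simp add: cip_diff_left)
    also have "\<dots> \<le> norm (?T x) * norm x"
      using Im_cip_le[of "?T x" x] by simp
    finally show ?thesis
      by (cases "x = 0") (auto simp: power2_eq_square)
  qed
  have inj: "inj_on ?T D"
  proof (rule inj_onI)
    fix x y assume xy: "x \<in> D" "y \<in> D" "?T x = ?T y"
    then have "m * norm (x - y) \<le> 0" using below[OF D_diff[OF xy(1,2)]] T_diff by simp
    then show "x = y" using m(1) by (simp add: mult_le_0_iff)
  qed
  have "closed (?T ` D)"
    unfolding closed_sequential_limits
  proof (intro allI impI, elim conjE)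
    fix y l assume "\<forall>n. y n \<in> ?T ` D" and l: "y \<longlonglongrightarrow> l"
    then obtain x where x: "\<And>n. x n \<in> D" "\<And>n. y n = ?T (x n)" unfolding image_iff by metis
    have "Cauchy x"
    proof (rule metric_CauchyI)
      fix e :: real assume "e > 0"
      then obtain M where M: "\<forall>i\<ge>M. \<forall>k\<ge>M. dist (y i) (y k) < m * e"
        using LIMSEQ_imp_Cauchy[OF l] m(1) by (meson metric_CauchyD mult_pos_pos)
      have "dist (x i) (x k) < e" if "i \<ge> M" "k \<ge> M" for i k
      proof -
        have "m * dist (x i) (x k) \<le> dist (y i) (y k)"
          using below[OF D_diff[OF x(1)[of i] x(1)[of k]]] T_diff[OF x(1)[of i] x(1)[of k]]
          by (simp add: dist_norm x(2))
        also have "\<dots> < m * e" using M that by blast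
        finally show ?thesis using m(1) by simp
      qed
      then show "\<exists>M. \<forall>i\<ge>M. \<forall>k\<ge>M. dist (x i) (x k) < e" by blast
    qed
    then obtain a where a: "x \<longlonglongrightarrow> a" unfolding Cauchy_convergent_iff convergent_def by blast
    have "(\<lambda>n. y n + act z (x n)) \<longlonglongrightarrow> l + act z a"
      by (intro tendsto_intros a l)
    then have "(\<lambda>n. X (x n)) \<longlonglongrightarrow> l + act z a" by (simp add: x(2))
    from X_closed[OF x(1) a this] show "l \<in> ?T ` D"
      by (auto simp: image_iff intro!: bexI[of _ a] dest: sym)
  qed
  moreover have "closure (?T ` D) = UNIV"
  proof (rule closure_subspace_eq_UNIV)
    show "subspace (?T ` D)"
    proof (rule subspaceI)
      show "0 \<in> ?T ` D" using T_diff[OF D_0 D_0] D_0 by (auto simp: image_iff intro!: bexI[of _ 0])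
      show "a + b \<in> ?T ` D" if ab: "a \<in> ?T ` D" "b \<in> ?T ` D" for a b
      proof -
        obtain x y where "x \<in> D" "y \<in> D" "a = ?T x" "b = ?T y" using ab by blast
        then show ?thesis by (intro image_eqI[of _ _ "x + y"]) (simp_all add: T_add D_add)
      qed
      show "c *\<^sub>R a \<in> ?T ` D" if a: "a \<in> ?T ` D" for c a
      proof -
        obtain x where "x \<in> D" "a = ?T x" using a by blast
        then show ?thesis
          using T_cscale[of x "of_real c"] D_cscale[of x "of_real c"]
          by (intro image_eqI[of _ _ "c *\<^sub>R x"]) simp_all
      qed
    qed
    fix w assume w: "\<And>y. y \<in> ?T ` D \<Longrightarrow> inner w y = 0"
    have "cip (?T x) w = 0" if x: "x \<in> D" for x
    proof -
      have "inner w (?T x) = 0" using w x by blast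
      moreover have "inner w (imul (?T x)) = 0"
        using w[OF imageI[OF D_cscale[OF x, of \<i>]]] unfolding T_cscale[OF x] by simp
      ultimately show ?thesis
        by (rule cip_eq_0I)
    qed
    then have "\<forall>x\<in>D. cip (X x) w = cip x (act (vec_cnj z) w)"
      by (simp add: cip_diff_left cip_act_adjoint)
    then have wD: "w \<in> D" and Xw: "act (vec_cnj z) w = X w" using X_adjoint by blast+
    have "Im (cip (X w) w) = 0"
      using X_sym[OF wD wD] cip_commute[of "X w" w] by (auto simp: complex_eq_iff)
    then have "Im (cip (act z w) w) = 0"
      unfolding Xw[symmetric] cip_act_adjoint[of z w w] by (subst cip_commute) simp
    then have "m * (norm w)\<^sup>2 \<le> 0" using Im_cip_act_ge[OF m(2), of w] by simp
    then show "w = 0" using m(1) by (simp add: mult_le_0_iff)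
  qed
  ultimately have "?T ` D = UNIV" by (simp add: closure_closed)
  then show ?thesis using inj by (simp add: bij_betw_def)
qed

text \<open>J lists the coefficients of a vector against a countable total set. Injectivity of J is
  enough, without isometry, because the inner product on the image may be chosen: it is the one
  transported back by g. Solving the equation for one x per z is enough too, as
  \<open>bij_pencil\<close> supplies uniqueness.\<close>

lemma has_resolvent_representationI:
  assumes f: "\<And>z. z \<in> poly_half_plane \<Longrightarrow>
    \<exists>x\<in>D. X x - act z x = v \<and> f z = of_real C + cip x v"
  shows "has_resolvent_representation f"
proof -
  obtain E :: "'m set" where E: "countable E" "\<And>x. (\<forall>e\<in>E. inner x e = 0) \<Longrightarrow> x = 0"
    using countable_total by blast
  \<comment> \<open>Inserting 0 gives a nonempty set to enumerate even if E is empty, and being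
    orthogonal to 0 is no condition.\<close>
  define e where "e = from_nat_into (insert 0 E)"
  have range_e: "range e = insert 0 E"
    unfolding e_def using E by (intro range_from_nat_into) auto
  define J :: "'m \<Rightarrow> nat \<Rightarrow> complex" where "J x = (\<lambda>n. cip x (e n))" for x
  have J_add: "J (x + y) = J x + J y" and J_diff: "J (x - y) = J x - J y" for x y
    by (auto simp: J_def cip_add_left cip_diff_left)
  define scale :: "complex \<Rightarrow> (nat \<Rightarrow> complex) \<Rightarrow> nat \<Rightarrow> complex" where "scale c f = (\<lambda>n. c * f n)" for c f
  have J_cscale: "J (cscale c x) = scale c (J x)" for c x
    by (simp add: J_def scale_def cip_cscale_left)
  have J0: "J 0 = 0" by (auto simp: J_def)
  have J_sum: "J (sum g A) = (\<Sum>a\<in>A. J (g a))" for g and A :: "'d set"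
    by (induction A rule: infinite_finite_induct) (simp_all add: J_add J0)
  have "inj J"
  proof (rule injI)
    fix x y assume "J x = J y"
    then have "cip (x - y) (e n) = 0" for n by (simp add: J_def cip_diff_left fun_eq_iff)
    then have "inner (x - y) a = 0" if "a \<in> range e" for a using that Re_cip by (metis imageE zero_complex.simps(1))
    then have "x - y = 0" using range_e by (intro E(2)) auto
    then show "x = y" by simp
  qed
  define g where "g = inv J"
  have g [simp]: "g (J x) = x" for x by (simp add: g_def \<open>inj J\<close>)
  have J_eq: "J x = J y \<longleftrightarrow> x = y" for x y using \<open>inj J\<close> by (rule inj_eq)
  define ip where "ip = (\<lambda>f h. cip (g f) (g h))"
  have ip_J [simp]: "ip (J x) (J y) = cip x y" for x y by (simp add: ip_def)
  have nrm: "sqrt (Re (ip (J x) (J x))) = norm x" for x by (simp add: cip_self)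
  let ?H = "range J"
  interpret vs: vector_space scale
    by unfold_locales (auto simp: scale_def algebra_simps)
  have subJ: "vs.subspace (J ` A)"
    if "0 \<in> A" "\<And>x y. x \<in> A \<Longrightarrow> y \<in> A \<Longrightarrow> x + y \<in> A" "\<And>c x. x \<in> A \<Longrightarrow> cscale c x \<in> A" for A
  proof (rule vs.subspaceI)
    show "0 \<in> J ` A" using that(1) J0 by (metis imageI)
    show "x + y \<in> J ` A" if xy: "x \<in> J ` A" "y \<in> J ` A" for x y
      using that \<open>\<And>x y. x \<in> A \<Longrightarrow> y \<in> A \<Longrightarrow> x + y \<in> A\<close> by (auto simp flip: J_add)
    show "scale c x \<in> J ` A" if "x \<in> J ` A" for c x
      using that \<open>\<And>c x. x \<in> A \<Longrightarrow> cscale c x \<in> A\<close> by (auto simp flip: J_cscale)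
  qed
  have chs: "complex_hilbert_space scale ?H ip"
  proof (unfold_locales)
    show "vs.subspace ?H" by (rule subJ) auto
    fix s :: "nat \<Rightarrow> nat \<Rightarrow> complex"
    assume "\<And>n. s n \<in> ?H"
      and ca: "\<And>e. 0 < e \<Longrightarrow> \<exists>N. \<forall>m\<ge>N. \<forall>n\<ge>N. sqrt (Re (ip (s m - s n) (s m - s n))) < e"
    then obtain x where s: "\<And>n. s n = J (x n)" unfolding image_iff by metis
    have "Cauchy x"
      unfolding Cauchy_def dist_norm using ca unfolding s by (simp only: nrm flip: J_diff) blast
    then obtain l where "x \<longlonglongrightarrow> l" unfolding Cauchy_convergent_iff convergent_def by blast
    then have "(\<lambda>n. norm (x n - l)) \<longlonglongrightarrow> 0"
      using LIM_zero tendsto_norm_zero by blast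
    then show "\<exists>l\<in>?H. (\<lambda>n. sqrt (Re (ip (s n - l) (s n - l)))) \<longlonglongrightarrow> 0"
      unfolding s by (intro bexI[of _ "J l"]) (simp_all only: nrm rangeI flip: J_diff)
  qed (auto simp: cip_add_left cip_cscale_left cip_commute[symmetric] cip_self J0
      simp flip: J_add J_cscale intro: cip_commute)
  interpret H: complex_hilbert_space scale ?H ip by (rule chs)
  define X' where "X' f = J (X (g f))" for f
  define P' where "P' r f = J (P r (g f))" for r f
  have lin: "H.linear_operator (J ` D) X'"
    unfolding H.linear_operator_def
    by (intro conjI subJ D_0 D_add D_cscale)
      (auto simp: X'_def X_add X_cscale simp flip: J_add J_cscale)
  have dns: "H.dense_in_carrier (J ` D)"
    unfolding H.dense_in_carrier_def
  proof (intro conjI ballI allI impI)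
    show "J ` D \<subseteq> ?H" by blast
    fix x and \<epsilon> :: real assume "x \<in> ?H" "\<epsilon> > 0"
    then obtain a where a: "x = J a" by blast
    have "a \<in> closure D" by (simp add: dense_domain)
    then obtain y where "y \<in> D" "dist y a < \<epsilon>" using \<open>\<epsilon> > 0\<close> closure_approachable by blast
    then show "\<exists>y\<in>J ` D. sqrt (Re (ip (x - y) (x - y))) < \<epsilon>"
      unfolding a by (intro bexI[of _ "J y"]) (simp_all only: nrm dist_norm norm_minus_commute imageI flip: J_diff)
  qed
  have sa: "H.self_adjoint (J ` D) X'"
    unfolding H.self_adjoint_def
  proof (intro conjI lin dns set_eqI)
    fix p :: "(nat \<Rightarrow> complex) \<times> (nat \<Rightarrow> complex)"
    obtain a b where p: "p = (a, b)" by (cases p)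
    have 1: "p \<in> H.adjoint_graph (J ` D) X' \<longleftrightarrow>
        (\<exists>y w. a = J y \<and> b = J w \<and> (\<forall>x\<in>D. cip (X x) y = cip x w))"
      unfolding H.adjoint_graph_def p X'_def by auto blast
    have 2: "p \<in> (\<lambda>x. (x, X' x)) ` J ` D \<longleftrightarrow> (\<exists>y w. a = J y \<and> b = J w \<and> y \<in> D \<and> w = X y)"
      unfolding p X'_def by auto
    show "p \<in> H.adjoint_graph (J ` D) X' \<longleftrightarrow> p \<in> (\<lambda>x. (x, X' x)) ` J ` D"
      unfolding 1 2 X_adjoint ..
  qed
  have proj: "H.orthogonal_projection (P' r)" for r
    unfolding H.orthogonal_projection_def H.linear_operator_def
    by (intro conjI subJ)
      (auto simp: P'_def P_add P_cscale P_idem P_sym simp flip: J_add J_cscale)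
  have psum: "\<forall>x\<in>?H. (\<Sum>r\<in>UNIV. P' r x) = x"
    by (auto simp: P'_def P_sum simp flip: J_sum)
  have rep: "let T = (\<lambda>x. X' x - (\<Sum>r\<in>UNIV. scale (z $ r) (P' r x)))
      in bij_betw T (J ` D) ?H \<and> f z = of_real C + ip (inv_into (J ` D) T (J v)) (J v)"
    if z: "z \<in> poly_half_plane" for z
  proof -
    define T where "T = (\<lambda>x. X' x - (\<Sum>r\<in>UNIV. scale (z $ r) (P' r x)))"
    have TJ: "T (J x) = J (X x - act z x)" for x
      unfolding T_def X'_def P'_def act_def by (simp add: J_diff J_sum J_cscale)
    note bij = bij_pencil[OF z]
    have bT: "bij_betw T (J ` D) ?H"
      unfolding bij_betw_def
    proof
      show "inj_on T (J ` D)"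
        using bij by (auto simp: inj_on_def TJ J_eq bij_betw_def)
      have "T ` J ` D = J ` (\<lambda>x. X x - act z x) ` D" by (auto simp: image_iff TJ)
      then show "T ` J ` D = ?H" using bij by (simp add: bij_betw_def)
    qed
    obtain x where x: "x \<in> D" "X x - act z x = v" "f z = of_real C + cip x v" using f z by blast
    have "inv_into (J ` D) T (J v) = J x"
      using x bT by (intro inv_into_f_eq) (auto simp: TJ bij_betw_def)
    then show ?thesis unfolding Let_def T_def[symmetric] using bT x(3) by simp
  qed
  show ?thesis
    unfolding has_resolvent_representation_def
    by (intro exI[of _ scale] exI[of _ ?H] exI[of _ ip] exI[of _ "J ` D"] exI[of _ X']
        exI[of _ "J v"] exI[of _ C] exI[of _ P'] conjI allI ballI chs sa proj psum[rule_format] rangeI rep)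
qed

end

section \<open>Self-adjoint relations\<close>

definition sform :: "'k \<times> 'k \<Rightarrow> 'k \<times> 'k::separable_hilbert \<Rightarrow> complex" where
  "sform p q = cip (snd p) (fst q) - cip (fst p) (snd q)"

text \<open>The adjoint of the linear relation spanned by S, meaningful without a dense domain.
  \<open>S \<subseteq> ann S\<close> says that S is symmetric, and \<open>ann T = T\<close> that T
  is self-adjoint. An annihilator is a closed complex subspace, so the single equation
  \<open>ann T = T\<close> carries linearity and closedness of T.\<close>

definition ann :: "('k \<times> 'k::separable_hilbert) set \<Rightarrow> ('k \<times> 'k) set" where
  "ann S = {p. \<forall>q\<in>S. sform q p = 0}"

lemma sform_commute: "sform q p = - cnj (sform p q)"
  by (simp add: sform_def flip: cip_commute)

lemma sform_add_right: "sform q (p + p') = sform q p + sform q p'"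
  and sform_diff_right: "sform q (p - p') = sform q p - sform q p'"
  and sform_cscale_right: "sform q (cscale c p) = cnj c * sform q p"
  and sform_zero_right [simp]: "sform q 0 = 0"
  by (simp_all add: sform_def cip_add_right cip_diff_right cip_cscale_right algebra_simps)

lemma sform_diff_left: "sform (q - q') p = sform q p - sform q' p"
  by (simp add: sform_def cip_diff_left)

lemma ann_add: "p \<in> ann S \<Longrightarrow> p' \<in> ann S \<Longrightarrow> p + p' \<in> ann S"
  and ann_diff: "p \<in> ann S \<Longrightarrow> p' \<in> ann S \<Longrightarrow> p - p' \<in> ann S"
  and ann_cscale: "p \<in> ann S \<Longrightarrow> cscale c p \<in> ann S"
  and ann_zero: "0 \<in> ann S"
  by (simp_all add: ann_def sform_add_right sform_diff_right sform_cscale_right)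

lemma ann_antimono: "S \<subseteq> S' \<Longrightarrow> ann S' \<subseteq> ann S"
  by (auto simp: ann_def)

lemma sform_eq_0_commute: "sform q p = 0 \<Longrightarrow> sform p q = 0"
  by (subst sform_commute) simp

lemma ann_ann_superset: "S \<subseteq> ann (ann S)"
  by (auto simp: ann_def intro: sform_eq_0_commute)

lemma ann_ann_ann: "ann (ann (ann S)) = ann S"
  by (meson ann_ann_superset ann_antimono equalityI)

lemma ann_closed:
  assumes "\<And>n. p n \<in> ann S" "p \<longlonglongrightarrow> a"
  shows "a \<in> ann S"
  unfolding ann_def
proof (intro CollectI ballI)
  fix q assume q: "q \<in> S"
  have "(\<lambda>n. sform q (p n)) \<longlonglongrightarrow> sform q a"
    unfolding sform_def by (intro tendsto_intros assms)
  moreover have "sform q (p n) = 0" for n using assms(1) q by (auto simp: ann_def)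
  ultimately show "sform q a = 0" by (simp add: LIMSEQ_const_iff)
qed

lemma ann_sform: "ann T = T \<Longrightarrow> p \<in> T \<Longrightarrow> q \<in> T \<Longrightarrow> sform p q = 0"
  unfolding ann_def by blast

text \<open>On two copies of the space, the second carrying the opposite form, the pairs \<open>(a, b)\<close> with
  \<open>a, b \<in> ann S\<close> that agree modulo \<open>ann (ann S)\<close> form a Lagrangian subspace. It contains
  \<open>S \<times> 0\<close>, so no deficiency indices have to be matched.\<close>

lemma self_adjoint_extension:
  fixes S :: "((complex \<times> 'm::separable_hilbert) \<times> (complex \<times> 'm)) set"
  assumes S: "S \<subseteq> ann S"
  obtains T :: "((complex \<times> ('m \<times> (complex \<times> 'm))) \<times> (complex \<times> ('m \<times> (complex \<times> 'm)))) set"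
  where "ann T = T"
    and "\<And>\<alpha> m \<beta> n. ((\<alpha>, m), (\<beta>, n)) \<in> S \<Longrightarrow> ((\<alpha>, (m, 0)), (\<beta>, (n, 0))) \<in> T"
proof -
  define i1 :: "(complex \<times> ('m \<times> (complex \<times> 'm))) \<times> (complex \<times> ('m \<times> (complex \<times> 'm))) \<Rightarrow>
      (complex \<times> 'm) \<times> (complex \<times> 'm)"
    where "i1 = (\<lambda>((\<alpha>, (m, k)), (\<beta>, (n, l))). ((\<alpha>, m), (\<beta>, n)))"
  \<comment> \<open>The minus sign on l makes the natural form of the second copy the opposite
    one.\<close>
  define i2 :: "(complex \<times> ('m \<times> (complex \<times> 'm))) \<times> (complex \<times> ('m \<times> (complex \<times> 'm))) \<Rightarrow>
      (complex \<times> 'm) \<times> (complex \<times> 'm)"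
    where "i2 = (\<lambda>((\<alpha>, (m, k)), (\<beta>, (n, l))). (k, - l))"
  have form: "sform p q = sform (i1 p) (i1 q) - sform (i2 p) (i2 q)" for p q
    by (auto simp: sform_def i1_def i2_def cip_Pair split: prod.splits)
  have surj: "\<exists>p. i1 p = a \<and> i2 p = b" for a b
  proof (intro exI conjI)
    let ?p = "((fst (fst a), (snd (fst a), fst b)), (fst (snd a), (snd (snd a), - snd b)))"
    show "i1 ?p = a" "i2 ?p = b" by (auto simp: i1_def i2_def)
  qed
  define T where "T = {p. i1 p \<in> ann S \<and> i2 p \<in> ann S \<and> i1 p - i2 p \<in> ann (ann S)}"
  have "T \<subseteq> ann T"
    unfolding ann_def[of T]
  proof (intro subsetI CollectI ballI)
    fix p q assume p: "p \<in> T" and q: "q \<in> T"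
    \<comment> \<open>After this splitting each term pairs an element of \<open>ann S\<close> with
      one of \<open>ann (ann S)\<close>.\<close>
    have "sform q p = sform (i1 q - i2 q) (i1 p) + sform (i2 q) (i1 p - i2 p)"
      by (simp add: form sform_diff_left sform_diff_right)
    moreover have "sform (i1 q - i2 q) (i1 p) = 0"
      using p q by (intro sform_eq_0_commute[of "i1 p"]) (auto simp: T_def ann_def[of "ann S"])
    moreover have "sform (i2 q) (i1 p - i2 p) = 0"
      using p q by (auto simp: T_def ann_def[of "ann S"])
    ultimately show "sform q p = 0" by simp
  qed
  moreover have "ann T \<subseteq> T"
  proof
    fix p assume p: "p \<in> ann T"
    have sub: "ann (ann S) \<subseteq> ann S" using S by (rule ann_antimono)
    \<comment> \<open>The test pairs (a, 0), (0, b) and (a, a) yield in turn the three conditions in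
      the definition of T.\<close>
    have *: "sform a (i1 p) - sform b (i2 p) = 0"
      if "a \<in> ann S" "b \<in> ann S" "a - b \<in> ann (ann S)" for a b
    proof -
      obtain q where "i1 q = a" "i2 q = b" using surj by blast
      then have "q \<in> T" using that by (simp add: T_def)
      then have "sform q p = 0" using p by (simp add: ann_def)
      then show ?thesis by (simp add: form \<open>i1 q = a\<close> \<open>i2 q = b\<close>)
    qed
    have z: "sform 0 r = 0" for r :: "(complex \<times> 'm) \<times> (complex \<times> 'm)"
      by (simp add: sform_def)
    have "i1 p \<in> ann (ann (ann S))"
      unfolding ann_def[of "ann (ann S)"]
    proof (intro CollectI ballI)
      fix a assume "a \<in> ann (ann S)"
      then show "sform a (i1 p) = 0" using *[of a 0] sub by (auto simp: z ann_zero)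
    qed
    moreover have "i2 p \<in> ann (ann (ann S))"
      unfolding ann_def[of "ann (ann S)"]
    proof (intro CollectI ballI)
      fix b assume b: "b \<in> ann (ann S)"
      have "0 - b \<in> ann (ann S)" using b ann_zero ann_diff by blast
      then show "sform b (i2 p) = 0" using *[of 0 b] sub b by (auto simp: z ann_zero)
    qed
    moreover have "i1 p - i2 p \<in> ann (ann S)"
      unfolding ann_def[of "ann S"]
    proof (intro CollectI ballI)
      fix a assume "a \<in> ann S"
      then show "sform a (i1 p - i2 p) = 0" using *[of a a] by (simp add: ann_zero sform_diff_right)
    qed
    ultimately show "p \<in> T" by (simp add: T_def ann_ann_ann)
  qed
  ultimately have "ann T = T" by blast
  moreover have "((\<alpha>, (m, 0)), (\<beta>, (n, 0))) \<in> T" if "((\<alpha>, m), (\<beta>, n)) \<in> S" for \<alpha> m \<beta> n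
  proof -
    have z: "(0, - 0) = (0 :: (complex \<times> 'm) \<times> (complex \<times> 'm))" by (simp add: zero_prod_def)
    show ?thesis
      using that S ann_ann_superset[of S] ann_zero[of S]
      by (auto simp: T_def i1_def i2_def z zero_prod_def[symmetric])
  qed
  ultimately show thesis by (rule that)
qed

text \<open>Up to the factor sqrt (1 + t^2), rotation by arctan t: a pair (x, \<lambda> x) becomes
  (1 - t \<lambda>) x, (\<lambda> + t) x, of slope \<open>rho t\<close> \<lambda>. Since F enters
  the pairs as -F, it is \<open>rot (- t)\<close> that applies \<open>rho t\<close> to F.\<close>

definition rot :: "real \<Rightarrow> 'k \<times> 'k \<Rightarrow> 'k \<times> 'k::separable_hilbert" where
  "rot t p = (fst p - t *\<^sub>R snd p, snd p + t *\<^sub>R fst p)"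

lemma sform_rot: "sform (rot t p) (rot t q) = (1 + t\<^sup>2) * sform p q"
  by (simp add: sform_def rot_def cip_add_left cip_add_right cip_diff_left cip_diff_right
      cip_scaleR_left cip_scaleR_right algebra_simps power2_eq_square)

lemma rot_scaleR: "rot t (c *\<^sub>R p) = c *\<^sub>R rot t p"
  by (simp add: rot_def prod_eq_iff algebra_simps)

lemma rot_rot: "rot t (rot (- t) p) = (1 + t\<^sup>2) *\<^sub>R p"
  by (simp add: rot_def prod_eq_iff algebra_simps power2_eq_square)

lemma ann_scaleR: "p \<in> ann S \<Longrightarrow> c *\<^sub>R p \<in> ann S"
  using ann_cscale[of p S "of_real c"] by simp

lemma one_plus_square_ne_0: "1 + t\<^sup>2 \<noteq> (0::real)"
  by (smt (verit) zero_le_power2)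

text \<open>\<open>rot t\<close> multiplies the form by the nonzero number 1 + t^2 and is
  invertible, with inverse a multiple of \<open>rot (- t)\<close>; hence it respects
  annihilators.\<close>

lemma ann_rot:
  assumes "ann T = T"
  shows "ann (rot t -` T) = rot t -` T"
proof -
  have nz: "1 + (complex_of_real t)\<^sup>2 \<noteq> 0"
    using one_plus_square_ne_0[of t] by (metis of_real_1 of_real_add of_real_eq_0_iff of_real_power)
  have T: "c *\<^sub>R p \<in> T" if "p \<in> T" for c p
    using ann_scaleR[of p T c] assms that by simp
  have "p \<in> ann (rot t -` T) \<longleftrightarrow> rot t p \<in> ann T" for p
  proof
    assume p: "p \<in> ann (rot t -` T)"
    show "rot t p \<in> ann T"
      unfolding ann_def
    proof (intro CollectI ballI)
      fix q assume q: "q \<in> T"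
      let ?q = "(1 / (1 + t\<^sup>2)) *\<^sub>R rot (- t) q"
      have rq: "rot t ?q = q" using one_plus_square_ne_0[of t] by (simp add: rot_scaleR rot_rot)
      then have "sform ?q p = 0" using p q by (auto simp: ann_def)
      then show "sform q (rot t p) = 0" using sform_rot[of t ?q p] rq by simp
    qed
  next
    assume "rot t p \<in> ann T"
    then have "(1 + (complex_of_real t)\<^sup>2) * sform q p = 0" if "rot t q \<in> T" for q
      using that sform_rot[of t q p] by (auto simp: ann_def)
    then show "p \<in> ann (rot t -` T)"
      using nz by (auto simp: ann_def)
  qed
  then show ?thesis using assms by auto
qed

text \<open>For t \<noteq> 0 the pair makes y an eigenvector of T for -1/t; for t = 0 it lies in the
  multivalued part. Symmetry makes the vectors of distinct t orthogonal.\<close>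

lemma countable_eigenvalues:
  fixes T :: "('k \<times> 'k::separable_hilbert) set"
  assumes T: "ann T = T"
  shows "countable {t. \<exists>y. y \<noteq> 0 \<and> (- t *\<^sub>R y, y) \<in> T}"
proof -
  let ?E = "{t. \<exists>y. y \<noteq> 0 \<and> (- t *\<^sub>R y, y) \<in> T}"
  have "\<forall>t\<in>?E. \<exists>y. y \<noteq> 0 \<and> (- t *\<^sub>R y, y) \<in> T" by blast
  then obtain y where y: "\<And>t. t \<in> ?E \<Longrightarrow> y t \<noteq> 0" "\<And>t. t \<in> ?E \<Longrightarrow> (- t *\<^sub>R y t, y t) \<in> T"
    by (metis (no_types, lifting))
  show ?thesis
  proof (rule countable_orthogonal_family[of _ y])
    fix s t assume st: "s \<in> ?E" "t \<in> ?E" "s \<noteq> t"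
    have "sform (- s *\<^sub>R y s, y s) (- t *\<^sub>R y t, y t) = 0"
      by (intro ann_sform[OF T] y st)
    then have "(s - t) * cip (y s) (y t) = 0"
      by (simp add: sform_def cip_scaleR_left cip_scaleR_right algebra_simps)
    then have "cip (y s) (y t) = 0" using st(3) by simp
    then show "inner (y s) (y t) = 0" by (simp flip: Re_cip)
  qed (use y in blast)
qed

text \<open>The pair \<open>inf\<close> stands for the point at infinity. Subtracting multiples of
  it removes the scalar entry of a first component, and symmetry against it then forces the scalar
  entry of the second to be \<open>- cip x v\<close>. What is left is a self-adjoint relation R on
  the vector parts, a graph by \<open>single\<close>.\<close>

lemma (in projection_family) representation_of_self_adjoint_relation:
  fixes T :: "((complex \<times> 'm) \<times> (complex \<times> 'm)) set"
  assumes T: "ann T = T"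
    and inf: "((1, 0), (- of_real C, - v)) \<in> T"
    and single: "\<And>k. (0, k) \<in> T \<Longrightarrow> k = 0"
    and f: "\<And>z. z \<in> poly_half_plane \<Longrightarrow> \<exists>u. ((1, u), (- f z, act z u)) \<in> T"
  shows "has_resolvent_representation f"
proof -
  note T_add = ann_add[of _ T, unfolded T] and T_diff = ann_diff[of _ T, unfolded T]
    and T_cscale = ann_cscale[of _ T, unfolded T] and T_zero = ann_zero[of T, unfolded T]
  have c: "c = - cip x v" if "((0, x), (c, y)) \<in> T" for x c y
    using ann_sform[OF T that inf] by (simp add: sform_def cip_Pair eq_neg_iff_add_eq_0)
  define R where "R x y \<longleftrightarrow> ((0, x), (- cip x v, y)) \<in> T" for x y
  have R_add: "R (x + x') (y + y')" if "R x y" "R x' y'" for x x' y y'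
    using T_add[of "((0, x), (- cip x v, y))" "((0, x'), (- cip x' v, y'))"] that
    by (simp add: R_def cip_add_left)
  have R_cscale: "R (cscale a x) (cscale a y)" if "R x y" for a x y
    using T_cscale[of "((0, x), (- cip x v, y))" a] that
    by (simp add: R_def cip_cscale_left cscale_Pair)
  have R_unique: "y = y'" if "R x y" "R x y'" for x y y'
  proof -
    have "(0, (0, y - y')) \<in> T"
      using T_diff[OF that[unfolded R_def]] by (simp add: zero_prod_def)
    then show ?thesis using single by (fastforce simp: zero_prod_def)
  qed
  define D where "D = {x. \<exists>y. R x y}"
  define X where "X x = (THE y. R x y)" for x
  have X: "X x = y" if "R x y" for x y
    unfolding X_def using that R_unique by blast
  have RX: "R x (X x)" if "x \<in> D" for x using that X by (auto simp: D_def)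
  have DI: "x \<in> D" if "R x y" for x y using that by (auto simp: D_def)
  interpret self_adjoint_pencil P D X
  proof
    fix x y assume xy: "x \<in> D" "y \<in> D"
    show "x + y \<in> D" "X (x + y) = X x + X y"
      using R_add[OF RX[OF xy(1)] RX[OF xy(2)]] DI X by auto
  next
    fix x a assume x: "x \<in> D"
    show "cscale a x \<in> D" "X (cscale a x) = cscale a (X x)"
      using R_cscale[OF RX[OF x]] DI X by auto
  next
    show "0 \<in> D" using T_zero by (intro DI[of 0 0]) (simp add: R_def zero_prod_def)
  next
    fix y w
    have "R y w" if *: "\<forall>x\<in>D. cip (X x) y = cip x w"
    proof -
      have "((0, y), (- cip y v, w)) \<in> ann T"
        unfolding ann_def
      proof (intro CollectI ballI)
        fix q assume "q \<in> T"
        obtain \<alpha> x b y' where q: "q = ((\<alpha>, x), (b, y'))" by (metis prod.collapse)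
        \<comment> \<open>Removing \<alpha> times \<open>inf\<close> turns an arbitrary q of T into
          a pair of R, so testing against R decides membership in \<open>ann T\<close>.\<close>
        have "((0, x), (b + \<alpha> * of_real C, y' + cscale \<alpha> v)) \<in> T"
          using T_diff[OF \<open>q \<in> T\<close> T_cscale[OF inf, of \<alpha>]] by (simp add: q cscale_Pair)
        with c have "R x (y' + cscale \<alpha> v)" unfolding R_def by metis
        then have "cip (y' + cscale \<alpha> v) y = cip x w" using * DI X by metis
        then show "sform q ((0, y), (- cip y v, w)) = 0"
          by (simp add: q sform_def cip_Pair cip_add_left cip_cscale_left eq_diff_eq
              flip: cip_commute)
      qed
      then show ?thesis using T by (simp add: R_def)
    qed
    moreover have "cip (X x) y = cip x w" if "R y w" "x \<in> D" for x
      using ann_sform[OF T RX[OF \<open>x \<in> D\<close>, unfolded R_def] \<open>R y w\<close>[unfolded R_def]]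
      by (simp add: sform_def cip_Pair)
    ultimately show "(\<forall>x\<in>D. cip (X x) y = cip x w) \<longleftrightarrow> y \<in> D \<and> w = X y"
      using DI X RX by metis
  qed
  show ?thesis
  proof (rule has_resolvent_representationI[of v f C])
    fix z :: "complex ^ 'd" assume "z \<in> poly_half_plane"
    then obtain u where "((1, u), (- f z, act z u)) \<in> T" using f by blast
    from T_diff[OF this inf] have u: "((0, u), (of_real C - f z, act z u + v)) \<in> T" by simp
    then have "of_real C - f z = - cip u v" by (rule c)
    moreover from this u have "R u (act z u + v)" by (simp add: R_def)
    ultimately show "\<exists>x\<in>D. X x - act z x = v \<and> f z = of_real C + cip x v"
      using DI X by (intro bexI[of _ u]) (auto simp: algebra_simps)
  qed
qed

section \<open>Factorization of positive kernels\<close>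

text \<open>q may repeat points, while \<open>psd_kernel\<close> sums over sets of distinct points;
  d adds up the coefficients of indices with the same image.\<close>

lemma psd_kernel_comp:
  assumes A: "psd_kernel S A" and q: "q ` S' \<subseteq> S"
  shows "psd_kernel S' (\<lambda>n m. A (q n) (q m))"
  unfolding psd_kernel_def
proof (intro allI impI, elim conjE)
  fix T and c :: "_ \<Rightarrow> complex" assume T: "finite T" "T \<subseteq> S'"
  define d where "d p = (\<Sum>n\<in>{n\<in>T. q n = p}. c n)" for p
  have group: "(\<Sum>n\<in>T. g (q n) * c n) = (\<Sum>p\<in>q ` T. g p * d p)" for g :: "_ \<Rightarrow> complex"
  proof -
    have "(\<Sum>n\<in>T. g (q n) * c n) = (\<Sum>p\<in>q ` T. \<Sum>n\<in>{n\<in>T. q n = p}. g (q n) * c n)"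
      by (rule sum.image_gen[OF T(1)])
    also have "\<dots> = (\<Sum>p\<in>q ` T. g p * d p)"
      by (auto simp: d_def sum_distrib_left intro!: sum.cong)
    finally show ?thesis .
  qed
  have "(\<Sum>n\<in>T. \<Sum>m\<in>T. cnj (c n) * A (q m) (q n) * c m)
      = (\<Sum>n\<in>T. (\<Sum>p\<in>q ` T. A p (q n) * d p) * cnj (c n))"
    unfolding group[of "\<lambda>p. A p _", symmetric] by (simp add: sum_distrib_right sum_distrib_left mult_ac)
  also have "\<dots> = cnj (\<Sum>n\<in>T. cnj (\<Sum>p\<in>q ` T. A p (q n) * d p) * c n)" by simp
  also have "\<dots> = cnj (\<Sum>x\<in>q ` T. cnj (\<Sum>p\<in>q ` T. A p x * d p) * d x)"
    by (simp only: group[of "\<lambda>x. cnj (\<Sum>p\<in>q ` T. A p x * d p)"])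
  also have "\<dots> = (\<Sum>x\<in>q ` T. \<Sum>y\<in>q ` T. cnj (d x) * A y x * d y)"
    by (simp add: sum_distrib_left sum_distrib_right mult_ac)
  also have "\<dots> \<in> \<real>\<^sub>\<ge>\<^sub>0"
    using A T q unfolding psd_kernel_def by (meson dual_order.trans finite_imageI image_mono)
  finally show "(\<Sum>n\<in>T. \<Sum>m\<in>T. cnj (c n) * A (q m) (q n) * c m) \<in> \<real>\<^sub>\<ge>\<^sub>0" .
qed

lemma psd_kernelD:
  "psd_kernel UNIV A \<Longrightarrow> finite T \<Longrightarrow> (\<Sum>x\<in>T. \<Sum>y\<in>T. cnj (c x) * A y x * c y) \<in> \<real>\<^sub>\<ge>\<^sub>0"
  unfolding psd_kernel_def by blast

lemma psd_kernel_diag: "psd_kernel UNIV A \<Longrightarrow> A n n \<in> \<real>\<^sub>\<ge>\<^sub>0"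
  using psd_kernelD[of A "{n}" "\<lambda>_. 1"] by simp

lemma psd_kernel_pair:
  assumes A: "psd_kernel UNIV A" and "n \<noteq> m"
  shows "cnj a * A n n * a + cnj a * A m n * b + cnj b * A n m * a + cnj b * A m m * b \<in> \<real>\<^sub>\<ge>\<^sub>0"
  using psd_kernelD[OF A, of "{n, m}" "\<lambda>x. if x = n then a else b"] \<open>n \<noteq> m\<close>
  by (simp add: algebra_simps)

text \<open>Reality of the form at the coefficients (1, 1) and (1, \<i>) gives the imaginary and the
  real part of the identity.\<close>

lemma psd_kernel_hermitian:
  assumes A: "psd_kernel UNIV A"
  shows "A m n = cnj (A n m)"
proof (cases "n = m")
  case True
  then show ?thesis using psd_kernel_diag[OF A, of n] by (simp add: complex_eq_iff complex_nonneg_Reals_iff)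
next
  case False
  show ?thesis
    using psd_kernel_pair[OF A False, of 1 1] psd_kernel_pair[OF A False, of 1 \<i>]
      psd_kernel_diag[OF A, of n] psd_kernel_diag[OF A, of m]
    by (simp add: complex_eq_iff complex_nonneg_Reals_iff)
qed

lemma psd_kernel_zero_diag:
  assumes A: "psd_kernel UNIV A" and k: "A k k = 0"
  shows "A n k = 0"
proof (rule ccontr)
  assume nz: "A n k \<noteq> 0"
  then have "n \<noteq> k" using k by auto
  \<comment> \<open>With this s the form at the coefficients 1, b has real part a - 2 (a + 1) for a
    = Re (A n n), which is negative; A k k = 0 leaves no quadratic term in b.\<close>
  define s where "s = (Re (A n n) + 1) / (cmod (A n k))\<^sup>2"
  define b where "b = - of_real s * A n k"
  have "A n n + A k n * b + cnj b * A n k \<in> \<real>\<^sub>\<ge>\<^sub>0"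
    using psd_kernel_pair[OF A \<open>n \<noteq> k\<close>, of 1 b] k by simp
  then have "0 \<le> Re (A n n + A k n * b + cnj b * A n k)"
    by (simp add: complex_nonneg_Reals_iff)
  moreover have "A k n * b + cnj b * A n k = of_real (- 2 * s * (cmod (A n k))\<^sup>2)"
  proof -
    have "A k n * b + cnj b * A n k = - 2 * of_real s * (A n k * cnj (A n k))"
      unfolding b_def psd_kernel_hermitian[OF A, of k n] by simp
    then show ?thesis by (simp add: complex_norm_square[symmetric] del: of_real_power)
  qed
  then have "Re (A k n * b + cnj b * A n k) = - 2 * s * (cmod (A n k))\<^sup>2"
    by (metis Re_complex_of_real)
  moreover have "s * (cmod (A n k))\<^sup>2 = Re (A n n) + 1" using nz by (simp add: s_def)
  moreover have "Re (A n n) \<ge> 0"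
    using psd_kernel_diag[OF A, of n] by (simp add: complex_nonneg_Reals_iff)
  ultimately show False by simp
qed

text \<open>One Cholesky elimination step with pivot A k k. For a zero pivot, division by zero
  leaves A unchanged; a positive kernel then already has zero row and column k.\<close>

definition schur :: "nat \<Rightarrow> (nat \<Rightarrow> nat \<Rightarrow> complex) \<Rightarrow> nat \<Rightarrow> nat \<Rightarrow> complex" where
  "schur k A n m = A n m - A n k * A k m / A k k"

text \<open>Completing the square: the form of the Schur complement at d is the form of A at d + b,
  where b changes only the coefficient of k.\<close>

lemma psd_kernel_schur:
  assumes A: "psd_kernel UNIV A"
  shows "psd_kernel UNIV (schur k A)"
proof (cases "A k k = 0")
  case True
  then have "schur k A = A" by (simp add: schur_def fun_eq_iff)
  then show ?thesis using A by simp
next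
  case False
  show ?thesis
    unfolding psd_kernel_def
  proof (intro allI impI, elim conjE)
    fix T c assume T: "finite (T :: nat set)"
    define U where "U = insert k T"
    define d where "d x = (if x \<in> T then c x else (0::complex))" for x
    have U: "finite U" "k \<in> U" using T by (auto simp: U_def)
    define s where "s = (\<Sum>y\<in>U. A y k * d y)"
    \<comment> \<open>The correction at k that minimizes the form of A.\<close>
    define b where "b x = (if x = k then - s / A k k else 0)" for x
    have cs: "(\<Sum>x\<in>U. cnj (d x) * A k x) = cnj s"
      by (simp add: s_def psd_kernel_hermitian[OF A, of k] mult.commute)
    have herm: "cnj (A k k) = A k k" using psd_kernel_hermitian[OF A, of k k] by simp
    have 1: "(\<Sum>x\<in>U. \<Sum>y\<in>U. cnj (d x) * A y x * b y) = cnj s * (- s / A k k)"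
      using U by (simp add: b_def if_distrib cong: if_cong flip: cs) (simp add: sum_distrib_right sum_divide_distrib sum_negf)
    have 2: "(\<Sum>x\<in>U. \<Sum>y\<in>U. cnj (b x) * A y x * d y) = (- cnj s / A k k) * s"
    proof -
      have "(\<Sum>x\<in>U. \<Sum>y\<in>U. cnj (b x) * A y x * d y)
          = (\<Sum>x\<in>U. if x = k then \<Sum>y\<in>U. (- cnj s / A k k) * (A y k * d y) else 0)"
        by (intro sum.cong refl) (simp add: b_def herm mult_ac)
      then show ?thesis using U by (simp add: s_def sum_distrib_left)
    qed
    have 3: "(\<Sum>x\<in>U. \<Sum>y\<in>U. cnj (b x) * A y x * b y) = cnj s * s / A k k"
    proof -
      have "(\<Sum>x\<in>U. \<Sum>y\<in>U. cnj (b x) * A y x * b y)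
          = (\<Sum>x\<in>U. if x = k then \<Sum>y\<in>U. if y = k then cnj s * s / A k k else 0 else 0)"
        by (auto intro!: sum.cong simp: b_def herm False)
      then show ?thesis using U by simp
    qed
    have 4: "(\<Sum>x\<in>U. \<Sum>y\<in>U. cnj (d x) * (A y k * A k x / A k k) * d y) = cnj s * s / A k k"
    proof -
      have "(\<Sum>x\<in>U. \<Sum>y\<in>U. cnj (d x) * (A y k * A k x / A k k) * d y)
          = (\<Sum>x\<in>U. \<Sum>y\<in>U. (cnj (d x) * A k x) * ((A y k * d y) / A k k))"
        by (intro sum.cong refl) simp
      also have "\<dots> = cnj s * (s / A k k)"
        unfolding sum_product[symmetric] cs by (simp add: s_def sum_divide_distrib)
      finally show ?thesis by simp
    qed
    have "(\<Sum>x\<in>T. \<Sum>y\<in>T. cnj (c x) * schur k A y x * c y)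
        = (\<Sum>x\<in>U. \<Sum>y\<in>U. cnj (d x) * schur k A y x * d y)"
    proof -
      have "(\<Sum>y\<in>T. cnj (c x) * schur k A y x * c y) = (\<Sum>y\<in>U. cnj (c x) * schur k A y x * d y)" for x
        using U by (intro sum.mono_neutral_cong_left) (auto simp: U_def d_def)
      then show ?thesis
        using U by (intro sum.mono_neutral_cong_left) (auto simp: U_def d_def)
    qed
    also have "\<dots> = (\<Sum>x\<in>U. \<Sum>y\<in>U. cnj (d x) * A y x * d y) - cnj s * s / A k k"
      unfolding 4[symmetric] sum_subtractf[symmetric]
      by (intro sum.cong refl) (simp add: schur_def algebra_simps)
    also have "\<dots> = (\<Sum>x\<in>U. \<Sum>y\<in>U. cnj (d x + b x) * A y x * (d y + b y))"
    proof -
      have "(\<Sum>x\<in>U. \<Sum>y\<in>U. cnj (d x + b x) * A y x * (d y + b y))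
          = (\<Sum>x\<in>U. \<Sum>y\<in>U. cnj (d x) * A y x * d y) + (\<Sum>x\<in>U. \<Sum>y\<in>U. cnj (d x) * A y x * b y)
          + (\<Sum>x\<in>U. \<Sum>y\<in>U. cnj (b x) * A y x * d y) + (\<Sum>x\<in>U. \<Sum>y\<in>U. cnj (b x) * A y x * b y)"
        unfolding sum.distrib[symmetric] by (intro sum.cong refl) (simp add: algebra_simps)
      then show ?thesis unfolding 1 2 3 by (simp add: field_simps)
    qed
    also have "\<dots> \<in> \<real>\<^sub>\<ge>\<^sub>0" by (rule psd_kernelD[OF A U(1)])
    finally show "(\<Sum>x\<in>T. \<Sum>y\<in>T. cnj (c x) * schur k A y x * c y) \<in> \<real>\<^sub>\<ge>\<^sub>0" .
  qed
qed

lemma cip_l2_finite: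
  assumes "\<And>k. k \<ge> N \<Longrightarrow> coeff x k = 0"
  shows "cip x y = (\<Sum>k<N. coeff x k * cnj (coeff y k))"
proof -
  have "inner x w = (\<Sum>k<N. inner (coeff x k) (coeff w k))" for w
    unfolding inner_l2_def by (rule suminf_finite) (auto simp: assms not_less)
  then show ?thesis
    by (simp add: cip_def complex_eq_iff inner_complex_def algebra_simps Re_sum Im_sum)
qed

text \<open>Infinite Cholesky factorization by successive Schur complements.\<close>

lemma psd_kernel_factorization:
  assumes A: "psd_kernel UNIV A"
  obtains a :: "nat \<Rightarrow> l2" where "\<And>n m. A n m = cip (a n) (a m)"
proof -
  define B where "B = rec_nat A schur"
  have B0: "B 0 = A" and BS: "B (Suc k) = schur k (B k)" for k by (simp_all add: B_def)
  have psd: "psd_kernel UNIV (B k)" for k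
    by (induction k) (simp_all add: B0 BS A psd_kernel_schur)
  \<comment> \<open>Stage k clears row and column k and keeps the earlier ones zero; if the pivot is
    zero they vanish by \<open>psd_kernel_zero_diag\<close>.\<close>
  have vanish: "B k n m = 0" if "n < k \<or> m < k" for k n m
    using that
  proof (induction k arbitrary: n m)
    case (Suc k)
    note herm = psd_kernel_hermitian[OF psd[of k]]
    have z: "B k n k = 0 \<and> B k k n = 0" if "B k k k = 0" for n
      using psd_kernel_zero_diag[OF psd that] herm[of k n] by simp
    consider "n < k" | "m < k" | "n = k" | "m = k" using Suc.prems by linarith
    then show ?case
      using Suc.IH[of n m] Suc.IH[of n k] Suc.IH[of k m] z[of m] z[of n]
      by cases (auto simp: BS schur_def)
  qed simp
  \<comment> \<open>Column k of stage k over the square root of the pivot; for a zero pivot the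
    quotient is 0, in agreement with \<open>schur\<close> doing nothing.\<close>
  define f where "f n k = B k n k / of_real (sqrt (Re (B k k k)))" for n k
  have sm: "summable (\<lambda>k. (cmod (f n k))\<^sup>2)" for n
    by (rule summable_finite[of "{..n}"]) (auto simp: f_def vanish)
  have c: "coeff (Abs_l2 (f n)) k = f n k" for n k by (simp add: coeff_Abs[OF sm])
  have step: "f n k * cnj (f m k) = B k n m - B (Suc k) n m" for n m k
  proof -
    have "complex_of_real (sqrt (Re (B k k k))) * of_real (sqrt (Re (B k k k))) = B k k k"
      using psd_kernel_diag[OF psd, of k k]
      by (simp add: complex_nonneg_Reals_iff complex_eq_iff flip: of_real_mult)
    then show ?thesis
      by (simp add: f_def BS schur_def psd_kernel_hermitian[OF psd, of k k m])
  qed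
  have "A n m = cip (Abs_l2 (f n)) (Abs_l2 (f m))" for n m
  proof -
    \<comment> \<open>Row n has no coefficients beyond n, so the sum stops there, and the final term
      \<open>B (Suc n) n m\<close> vanishes.\<close>
    have "cip (Abs_l2 (f n)) (Abs_l2 (f m)) = (\<Sum>k<Suc n. B k n m - B (Suc k) n m)"
      by (subst cip_l2_finite[of "Suc n"]) (simp_all only: c step, simp add: f_def vanish)
    also have "\<dots> = B 0 n m - B (Suc n) n m" by (rule sum_lessThan_telescope')
    finally show ?thesis by (simp add: B0 vanish)
  qed
  then show thesis by (rule that)
qed

section \<open>Models of Loewner functions\<close>

type_synonym 'd model = "(l2 ^ 'd) \<times> (complex \<times> (l2 ^ 'd))"

text \<open>The summand by which the model is enlarged has to lie in the range of some projection;
  \<open>undefined\<close> is just an arbitrary index.\<close>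

definition model_proj :: "'d::finite \<Rightarrow> 'd model \<Rightarrow> 'd model" where
  "model_proj r x = ((\<chi> s. if s = r then fst x $ s else 0), (if r = undefined then snd x else 0))"

interpretation model: projection_family model_proj
proof
  fix r :: "'d::finite" and x y :: "'d model"
  show "model_proj r (x + y) = model_proj r x + model_proj r y"
    by (auto simp: model_proj_def vec_eq_iff)
  show "model_proj r (cscale c x) = cscale c (model_proj r x)" for c
    by (auto simp: model_proj_def vec_eq_iff prod_eq_iff)
  show "model_proj r (model_proj r x) = model_proj r x"
    by (auto simp: model_proj_def vec_eq_iff)
  show "cip (model_proj r x) y = cip x (model_proj r y)"
    by (auto simp: model_proj_def cip_prod[of _ y] cip_prod[of x] cip_vec intro!: sum.cong)
  have "(\<Sum>s\<in>(UNIV :: 'd set). if r = s then fst x $ r else 0) = fst x $ r" for r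
    by simp
  then show "(\<Sum>r\<in>UNIV. model_proj r x) = x"
    by (simp add: model_proj_def prod_eq_iff fst_sum snd_sum vec_eq_iff)
qed

lemma model_act: "model.act z (m, 0) = ((\<chi> r. cscale (z $ r) (m $ r)), 0)"
proof -
  have "(\<Sum>s\<in>UNIV. cscale (z $ s) (if r = s then m $ r else 0)) = cscale (z $ r) (m $ r)" for r
    by (simp add: if_distrib cong: if_cong)
  moreover have "model_proj r (m, 0) = ((\<chi> s. if s = r then m $ s else 0), 0)" for r
    by (auto simp: model_proj_def vec_eq_iff)
  ultimately show ?thesis
    by (simp add: model.act_def prod_eq_iff fst_sum snd_sum vec_eq_iff)
qed

text \<open>Symmetry of the generating pairs is the Loewner identity at q n and q m, with the factor
  of the r-th kernel as r-th coordinate. The sequence q is left free: it is taken convergent in the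
  proof of continuity, and dense afterwards.\<close>

lemma loewner_model:
  fixes F :: "complex ^ 'd::finite \<Rightarrow> complex"
  assumes F: "F \<in> loewner_class" and q: "range q \<subseteq> poly_half_plane"
  obtains T :: "((complex \<times> 'd model) \<times> (complex \<times> 'd model)) set" and u :: "nat \<Rightarrow> 'd model"
  where "ann T = T" "\<And>n. ((1, u n), (- F (q n), model.act (q n) (u n))) \<in> T"
proof -
  obtain A :: "'d \<Rightarrow> complex ^ 'd \<Rightarrow> complex ^ 'd \<Rightarrow> complex"
    where A: "\<And>r. psd_kernel poly_half_plane (A r)"
      "\<And>z w. z \<in> poly_half_plane \<Longrightarrow> w \<in> poly_half_plane \<Longrightarrow>
        F z - cnj (F w) = (\<Sum>r\<in>UNIV. (z $ r - cnj (w $ r)) * A r z w)"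
    using F unfolding loewner_class_def by blast
  have "\<exists>a :: nat \<Rightarrow> l2. \<forall>n m. A r (q n) (q m) = cip (a n) (a m)" for r
    using psd_kernel_factorization[OF psd_kernel_comp[OF A(1)[of r] q]] by metis
  then obtain a :: "'d \<Rightarrow> nat \<Rightarrow> l2" where a: "\<And>r n m. A r (q n) (q m) = cip (a r n) (a r m)"
    by metis
  define v where "v n = (\<chi> r. a r n)" for n
  define w where "w n = (\<chi> r. cscale (q n $ r) (v n $ r))" for n
  define S where "S = range (\<lambda>n. ((1 :: complex, v n), (- F (q n), w n)))"
  have "S \<subseteq> ann S"
  proof -
    have "sform ((1, v n), (- F (q n), w n)) ((1, v m), (- F (q m), w m)) = 0" for n m
    proof -
      have "F (q n) - cnj (F (q m)) = cip (w n) (v m) - cip (v n) (w m)"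
        using q by (subst A(2))
          (auto simp: a v_def w_def cip_vec cip_cscale_left cip_cscale_right algebra_simps sum_subtractf)
      then show ?thesis by (simp add: sform_def cip_Pair algebra_simps)
    qed
    then show ?thesis by (auto simp: S_def ann_def)
  qed
  then obtain T :: "((complex \<times> 'd model) \<times> (complex \<times> 'd model)) set" where T: "ann T = T"
    "\<And>\<alpha> m \<beta> n. ((\<alpha>, m), (\<beta>, n)) \<in> S \<Longrightarrow> ((\<alpha>, (m, 0)), (\<beta>, (n, 0))) \<in> T"
    using self_adjoint_extension by metis
  show thesis
  proof (rule that[of T "\<lambda>n. (v n, 0)"])
    show "((1, (v n, 0)), (- F (q n), model.act (q n) (v n, 0))) \<in> T" for n
      using T(2)[of 1 "v n" "- F (q n)" "w n"] by (simp add: S_def w_def model_act)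
  qed (rule T(1))
qed

section \<open>Lipschitz dependence of the vectors on the point, and extension from the countable
  set\<close>

context projection_family
begin

context
  fixes T :: "((complex \<times> 'm) \<times> (complex \<times> 'm)) set"
  assumes T: "ann T = T"
begin

lemma T_diff: "p \<in> T \<Longrightarrow> q \<in> T \<Longrightarrow> p - q \<in> T"
  using ann_diff[of p T q] T by simp

lemma T_closed: "(\<And>n. p n \<in> T) \<Longrightarrow> p \<longlonglongrightarrow> a \<Longrightarrow> a \<in> T"
  using ann_closed[of p T a] T by simp

lemma value_difference:
  assumes a: "((1, a), (- f, act z a)) \<in> T" and b: "((1, b), (- g, act w b)) \<in> T"
  shows "f - g = cip (act z a - act w b) b - cip (a - b) (act w b)"
proof -
  have "((0, a - b), (g - f, act z a - act w b)) \<in> T" using T_diff[OF a b] by simp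
  from ann_sform[OF T this b] show ?thesis by (simp add: sform_def cip_Pair algebra_simps)
qed

text \<open>The difference of the two pairs has scalar entry 0 in its first component, so its
  isotropy involves vectors alone: the form of act z (a - b) + act (z - w) b against a - b is real.
  Coercivity at z then bounds a - b.\<close>

lemma vector_difference_le:
  assumes a: "((1, a), (- f, act z a)) \<in> T" and b: "((1, b), (- g, act w b)) \<in> T"
    and m: "\<And>r. m \<le> Im (z $ r)"
  shows "m * norm (a - b) \<le> CARD('d) * norm (z - w) * norm b"
proof -
  have e: "act z a - act w b = act z (a - b) + act (z - w) b"
    by (simp add: act_diff act_diff_left)
  have "((0, a - b), (g - f, act z (a - b) + act (z - w) b)) \<in> T"
    using T_diff[OF a b] by (simp add: e)
  from ann_sform[OF T this this]
  have "cip (act z (a - b) + act (z - w) b) (a - b) = cnj (cip (act z (a - b) + act (z - w) b) (a - b))"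
    by (simp add: sform_def cip_Pair flip: cip_commute)
  then have "Im (cip (act z (a - b)) (a - b)) = - Im (cip (act (z - w) b) (a - b))"
    by (simp add: cip_add_left complex_eq_iff)
  then have "m * (norm (a - b))\<^sup>2 \<le> norm (act (z - w) b) * norm (a - b)"
    using Im_cip_act_ge[OF m, of "a - b"] Im_cip_le[of "act (z - w) b" "a - b"] by linarith
  also have "\<dots> \<le> (CARD('d) * norm (z - w) * norm b) * norm (a - b)"
    by (intro mult_right_mono norm_act_le) simp
  finally show ?thesis
    by (cases "a = b") (auto simp: power2_eq_square)
qed

end

end

lemma open_uniform_half_plane: "open {z :: complex ^ 'd::finite. \<forall>r. c < Im (z $ r)}"
proof -
  have "{z :: complex ^ 'd. \<forall>r. c < Im (z $ r)} = (\<Inter>r. {z. c < Im (z $ r)})" by blast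
  then show ?thesis by (auto intro!: open_INT open_Collect_less continuous_intros)
qed

text \<open>The class is defined without continuity; it comes from the Lipschitz estimate for the
  vectors.\<close>

lemma loewner_continuous:
  fixes F :: "complex ^ 'd::finite \<Rightarrow> complex"
  assumes F: "F \<in> loewner_class" and w: "w \<in> poly_half_plane"
    and z: "\<And>n. z n \<in> poly_half_plane" "z \<longlonglongrightarrow> w"
  shows "(\<lambda>n. F (z n)) \<longlonglongrightarrow> F w"
proof -
  \<comment> \<open>Putting w at index 0 places the limit and the sequence in the same relation
    T.\<close>
  define q where "q = case_nat w z"
  have "range q \<subseteq> poly_half_plane" using w z by (auto simp: q_def split: nat.splits)
  from loewner_model[OF F this]
  obtain T :: "((complex \<times> 'd model) \<times> (complex \<times> 'd model)) set" and u
    where T: "ann T = T" and u: "\<And>n. ((1, u n), (- F (q n), model.act (q n) (u n))) \<in> T"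
    by blast
  have u0: "((1, u 0), (- F w, model.act w (u 0))) \<in> T"
    and uS: "((1, u (Suc n)), (- F (z n), model.act (z n) (u (Suc n)))) \<in> T" for n
    using u[of 0] u[of "Suc n"] by (simp_all add: q_def)
  obtain m where m: "m > 0" "\<And>r. m \<le> Im (w $ r)"
    using poly_half_plane_lower_bound[OF w] by blast
  have "\<forall>\<^sub>F n in sequentially. z n \<in> {z. \<forall>r. m / 2 < Im (z $ r)}"
  proof (rule topological_tendstoD[OF z(2) open_uniform_half_plane])
    have "m / 2 < Im (w $ r)" for r using m(1) m(2)[of r] by linarith
    then show "w \<in> {z. \<forall>r. m / 2 < Im (z $ r)}" by simp
  qed
  then have ev: "\<forall>\<^sub>F n in sequentially.
      norm (u (Suc n) - u 0) \<le> (CARD('d) * norm (z n - w) * norm (u 0)) / (m / 2)"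
  proof eventually_elim
    case (elim n)
    then have "m / 2 * norm (u (Suc n) - u 0) \<le> CARD('d) * norm (z n - w) * norm (u 0)"
      by (intro model.vector_difference_le[OF T uS u0]) (auto intro: less_imp_le)
    then show ?case using m(1) by (simp add: field_simps)
  qed
  have "(\<lambda>n. (CARD('d) * norm (z n - w) * norm (u 0)) / (m / 2))
      \<longlonglongrightarrow> (CARD('d) * norm (w - w) * norm (u 0)) / (m / 2)"
    using m(1) by (intro tendsto_intros z) auto
  then have "(\<lambda>n. (CARD('d) * norm (z n - w) * norm (u 0)) / (m / 2)) \<longlonglongrightarrow> 0" by simp
  from Lim_null_comparison[OF ev this] have lim: "(\<lambda>n. u (Suc n)) \<longlonglongrightarrow> u 0"
    by (rule LIM_zero_cancel)
  have "F (z n) = F w + (cip (model.act (z n) (u (Suc n)) - model.act w (u 0)) (u 0)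
      - cip (u (Suc n) - u 0) (model.act w (u 0)))" for n
    using model.value_difference[OF T uS[of n] u0] by (simp add: algebra_simps)
  moreover have "(\<lambda>n. F w + (cip (model.act (z n) (u (Suc n)) - model.act w (u 0)) (u 0)
      - cip (u (Suc n) - u 0) (model.act w (u 0))))
     \<longlonglongrightarrow> F w + (cip (model.act w (u 0) - model.act w (u 0)) (u 0)
      - cip (u 0 - u 0) (model.act w (u 0)))"
    by (intro tendsto_intros model.tendsto_act lim z)
  ultimately show ?thesis by simp
qed

text \<open>Near z the coercivity constant is uniform, so the vectors at approximating points of the
  dense sequence are Cauchy. Closedness of T and continuity of F put the limit pair in T.\<close>

lemma loewner_relation:
  fixes F :: "complex ^ 'd::finite \<Rightarrow> complex"
  assumes F: "F \<in> loewner_class"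
  obtains T :: "((complex \<times> 'd model) \<times> (complex \<times> 'd model)) set"
  where "ann T = T"
    and "\<And>z. z \<in> poly_half_plane \<Longrightarrow> \<exists>u. ((1, u), (- F z, model.act z u)) \<in> T"
proof -
  obtain E :: "(complex ^ 'd) set" where E: "countable E" "\<And>X. open X \<Longrightarrow> X \<noteq> {} \<Longrightarrow> \<exists>d\<in>E. d \<in> X"
    using countable_dense_setE by blast
  define Q where "Q = E \<inter> poly_half_plane"
  have \<i>: "(\<chi> r. \<i>) \<in> (poly_half_plane :: (complex ^ 'd) set)"
    by (simp add: poly_half_plane_def upper_half_plane_def)
  have o: "open (poly_half_plane :: (complex ^ 'd) set)"
    using open_uniform_half_plane[of 0] by (simp add: poly_half_plane_def upper_half_plane_def)
  have "Q \<noteq> {}" using E(2)[OF o] \<i> by (auto simp: Q_def)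
  define q where "q = from_nat_into Q"
  have rq: "range q = Q"
    unfolding q_def by (rule range_from_nat_into[OF \<open>Q \<noteq> {}\<close>]) (simp add: Q_def E(1) countable_Int1)
  have "range q \<subseteq> poly_half_plane" by (simp add: rq Q_def)
  from loewner_model[OF F this]
  obtain T :: "((complex \<times> 'd model) \<times> (complex \<times> 'd model)) set" and u
    where T: "ann T = T" and u: "\<And>n. ((1, u n), (- F (q n), model.act (q n) (u n))) \<in> T"
    by blast
  have "\<exists>u. ((1, u), (- F z, model.act z u)) \<in> T" if z: "z \<in> poly_half_plane" for z
  proof -
    obtain m where m: "m > 0" "\<And>r. m \<le> Im (z $ r)"
      using poly_half_plane_lower_bound[OF z] by blast
    let ?U = "{z :: complex ^ 'd. \<forall>r. m / 2 < Im (z $ r)}"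
    have "m / 2 < Im (z $ r)" for r using m(1) m(2)[of r] by linarith
    then have zU: "z \<in> ?U" by simp
    have UP: "?U \<subseteq> poly_half_plane"
      using m(1) by (auto simp: poly_half_plane_def upper_half_plane_def intro: less_trans[of 0 "m / 2"])
    have "\<exists>n. q n \<in> ?U \<and> dist (q n) z < e" if "e > 0" for e
    proof -
      have "open (?U \<inter> ball z e)" by (intro open_Int open_uniform_half_plane open_ball)
      moreover have "z \<in> ?U \<inter> ball z e" using zU that by simp
      ultimately obtain d where "d \<in> E" "d \<in> ?U \<inter> ball z e" using E(2) by blast
      then have "d \<in> range q" using UP unfolding rq Q_def by blast
      then show ?thesis using \<open>d \<in> ?U \<inter> ball z e\<close> by (auto simp: dist_commute)
    qed
    then have "\<forall>i. \<exists>n. q n \<in> ?U \<and> dist (q n) z < inverse (real (Suc i))" by simp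
    then obtain k where k: "\<And>i. q (k i) \<in> ?U" "\<And>i. dist (q (k i)) z < inverse (real (Suc i))"
      by metis
    have qz: "(\<lambda>i. q (k i)) \<longlonglongrightarrow> z"
    proof (rule metric_tendsto_imp_tendsto[OF LIMSEQ_inverse_real_of_nat])
      show "\<forall>\<^sub>F i in sequentially. dist (q (k i)) z \<le> dist (inverse (real (Suc i))) 0"
        using k(2) by (auto intro!: always_eventually simp: less_imp_le)
    qed
    define c where "c = CARD('d) / (m / 2)"
    have c: "c > 0" using m(1) by (simp add: c_def)
    have est: "norm (u (k i) - u (k j)) \<le> c * norm (q (k i) - q (k j)) * norm (u (k j))" for i j
    proof -
      have "m / 2 * norm (u (k i) - u (k j)) \<le> CARD('d) * norm (q (k i) - q (k j)) * norm (u (k j))"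
        using k(1)[of i] by (intro model.vector_difference_le[OF T u u]) (auto intro: less_imp_le)
      then show ?thesis using m(1) by (simp add: c_def field_simps)
    qed
    \<comment> \<open>The Lipschitz bound contains the factor |u (k j)|, so boundedness is first
      obtained by comparison with index 0.\<close>
    obtain K where K: "K > 0" "\<And>j. norm (u (k j)) \<le> K"
    proof -
      obtain B where B: "\<And>i. norm (q (k i) - q (k 0)) \<le> B"
        using convergent_imp_Bseq[OF convergentI[OF tendsto_diff[OF qz tendsto_const[of "q (k 0)"]]]]
        by (auto simp: Bseq_def)
      have "norm (u (k i)) \<le> norm (u (k 0)) + c * B * norm (u (k 0)) + 1" for i
      proof -
        have "norm (u (k i) - u (k 0)) \<le> c * B * norm (u (k 0))"
          by (rule order_trans[OF est]) (use B c in \<open>auto intro!: mult_right_mono mult_left_mono\<close>)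
        then show ?thesis using norm_triangle_sub[of "u (k i)" "u (k 0)"] by linarith
      qed
      moreover have "B \<ge> 0" using B[of 0] by simp
      ultimately show thesis
        using c by (intro that[of "norm (u (k 0)) + c * B * norm (u (k 0)) + 1"]) (auto intro: add_nonneg_pos)
    qed
    have "Cauchy (\<lambda>i. u (k i))"
    proof (rule metric_CauchyI)
      fix e :: real assume "e > 0"
      then have "e / (c * K) > 0" using c K by simp
      then obtain M where M: "\<forall>i\<ge>M. \<forall>j\<ge>M. dist (q (k i)) (q (k j)) < e / (c * K)"
        using LIMSEQ_imp_Cauchy[OF qz] by (meson metric_CauchyD)
      have "dist (u (k i)) (u (k j)) < e" if "i \<ge> M" "j \<ge> M" for i j
      proof -
        have "dist (u (k i)) (u (k j)) \<le> c * dist (q (k i)) (q (k j)) * K"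
          unfolding dist_norm by (rule order_trans[OF est]) (use K c in \<open>auto intro!: mult_left_mono\<close>)
        also have "\<dots> < e"
          using M that c K by (auto simp: field_simps)
        finally show ?thesis .
      qed
      then show "\<exists>M. \<forall>i\<ge>M. \<forall>j\<ge>M. dist (u (k i)) (u (k j)) < e" by blast
    qed
    then obtain a where a: "(\<lambda>i. u (k i)) \<longlonglongrightarrow> a"
      unfolding Cauchy_convergent_iff convergent_def by blast
    have qk: "q (k i) \<in> poly_half_plane" for i using k(1) UP by blast
    have "(\<lambda>i. ((1, u (k i)), (- F (q (k i)), model.act (q (k i)) (u (k i)))))
        \<longlonglongrightarrow> ((1, a), (- F z, model.act z a))"
      by (intro tendsto_intros model.tendsto_act a qz loewner_continuous[OF F z qk])
    from model.T_closed[OF T _ this] show ?thesis using u by blast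
  qed
  then show thesis using T that by blast
qed

section \<open>Boundary behaviour\<close>

text \<open>Symmetry expresses the Gram entries of the vectors as difference quotients of F, and the
  first-order expansion makes all of them tend to c1. Hence |u n - u k|^2 tends to c1 - 2 c1 + c1 =
  0, and closedness of T gives the boundary pair.\<close>

lemma (in projection_family) boundary_vector:
  fixes T :: "((complex \<times> 'm) \<times> (complex \<times> 'm)) set" and c0 c1 x0 :: real
  assumes T: "ann T = T"
    and F: "\<And>z. z \<in> poly_half_plane \<Longrightarrow> \<exists>u. ((1, u), (- F z, act z u)) \<in> T"
    and lim: "((\<lambda>\<epsilon>. (F (\<chi> r. Complex x0 \<epsilon>) - c0 - \<i> * c1 * \<epsilon>) / of_real \<epsilon>) \<longlongrightarrow> 0) (at_right 0)"
  obtains u where "((1, u), (- of_real c0, x0 *\<^sub>R u)) \<in> T"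
proof -
  define \<epsilon> where "\<epsilon> n = inverse (real (Suc n))" for n
  have \<epsilon>: "\<epsilon> n > 0" for n by (simp add: \<epsilon>_def)
  have \<epsilon>0: "\<epsilon> \<longlonglongrightarrow> 0" unfolding \<epsilon>_def by (rule LIMSEQ_inverse_real_of_nat)
  then have "filterlim \<epsilon> (at_right 0) sequentially"
    by (rule tendsto_imp_filterlim_at_right) (simp add: \<epsilon>)
  define f where "f n = F (\<chi> r. Complex x0 (\<epsilon> n))" for n
  define R where "R n = f n - c0 - \<i> * c1 * \<epsilon> n" for n
  have R: "(\<lambda>n. R n / of_real (\<epsilon> n)) \<longlonglongrightarrow> 0"
    using filterlim_compose[OF lim \<open>filterlim \<epsilon> (at_right 0) sequentially\<close>] by (simp add: R_def f_def)
  have "(\<chi> r. Complex x0 (\<epsilon> n)) \<in> poly_half_plane" for n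
    by (simp add: poly_half_plane_def upper_half_plane_def \<epsilon>)
  then have "\<exists>u. ((1, u), (- f n, cscale (Complex x0 (\<epsilon> n)) u)) \<in> T" for n
    using F[of "\<chi> r. Complex x0 (\<epsilon> n)"] unfolding act_const f_def by blast
  then obtain u where u: "\<And>n. ((1, u n), (- f n, cscale (Complex x0 (\<epsilon> n)) (u n))) \<in> T" by metis
  \<comment> \<open>For the affine part c0 + \<i> c1 \<epsilon> the quotient of f n - cnj (f k) by
    \<i> (\<epsilon> n + \<epsilon> k) is exactly c1, so only remainders survive.\<close>
  have gram: "\<i> * of_real (\<epsilon> n + \<epsilon> k) * (cip (u n) (u k) - c1) = R n - cnj (R k)" for n k
  proof -
    have "f n - cnj (f k) = (Complex x0 (\<epsilon> n) - cnj (Complex x0 (\<epsilon> k))) * cip (u n) (u k)"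
      using ann_sform[OF T u[of n] u[of k]]
      by (simp add: sform_def cip_Pair cip_cscale_left cip_cscale_right algebra_simps)
    moreover have "Complex x0 (\<epsilon> n) - cnj (Complex x0 (\<epsilon> k)) = \<i> * of_real (\<epsilon> n + \<epsilon> k)"
      by (simp add: complex_eq_iff)
    ultimately have "\<i> * of_real (\<epsilon> n + \<epsilon> k) * cip (u n) (u k) = f n - cnj (f k)" by simp
    then show ?thesis by (simp add: R_def algebra_simps)
  qed
  have "Cauchy u"
  proof (rule metric_CauchyI)
    fix e :: real assume e: "e > 0"
    then have "\<forall>\<^sub>F n in sequentially. dist (R n / of_real (\<epsilon> n)) 0 < e\<^sup>2 / 8"
      by (intro tendstoD[OF R]) simp
    then obtain M where M: "\<And>n. n \<ge> M \<Longrightarrow> cmod (R n) / \<epsilon> n < e\<^sup>2 / 8"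
      using \<epsilon> by (auto simp: eventually_sequentially norm_divide abs_of_pos)
    \<comment> \<open>The squared distance takes the Gram entries with weights 1, -2, 1; errors of
      e^2 / 8 add up to at most e^2 / 2.\<close>
    have near: "\<bar>inner (u n) (u k) - c1\<bar> \<le> e\<^sup>2 / 8" if "n \<ge> M" "k \<ge> M" for n k
    proof -
      have R': "cmod (R i) \<le> e\<^sup>2 / 8 * \<epsilon> i" if "i \<ge> M" for i
        using M[OF that] \<epsilon>[of i] by (simp add: field_simps)
      have "(\<epsilon> n + \<epsilon> k) * cmod (cip (u n) (u k) - c1) = cmod (R n - cnj (R k))"
        using arg_cong[OF gram[of n k], of cmod] \<epsilon>[of n] \<epsilon>[of k]
        by (simp add: norm_mult flip: of_real_add)
      also have "\<dots> \<le> cmod (R n) + cmod (R k)"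
        using norm_triangle_ineq4[of "R n" "cnj (R k)"] by simp
      also have "\<dots> \<le> (\<epsilon> n + \<epsilon> k) * (e\<^sup>2 / 8)"
        using R'[OF that(1)] R'[OF that(2)] by (simp add: algebra_simps)
      finally have "cmod (cip (u n) (u k) - c1) \<le> e\<^sup>2 / 8"
        using \<epsilon>[of n] \<epsilon>[of k] by (simp only: mult_le_cancel_left_pos[OF add_pos_pos])
      then show ?thesis
        using abs_Re_le_cmod[of "cip (u n) (u k) - c1"] by (simp add: Re_cip)
    qed
    have "dist (u n) (u k) < e" if "n \<ge> M" "k \<ge> M" for n k
    proof -
      have "(norm (u n - u k))\<^sup>2 = inner (u n) (u n) - 2 * inner (u n) (u k) + inner (u k) (u k)"
        by (simp add: power2_norm_eq_inner inner_diff_left inner_diff_right inner_commute)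
      also have "\<dots> \<le> 4 * (e\<^sup>2 / 8)"
        using near[OF that(1) that(1)] near[OF that] near[OF that(2) that(2)] by linarith
      also have "\<dots> < e\<^sup>2" using e by simp
      finally show ?thesis using e by (simp add: dist_norm power2_less_imp_less)
    qed
    then show "\<exists>M. \<forall>n\<ge>M. \<forall>k\<ge>M. dist (u n) (u k) < e" by blast
  qed
  then obtain a where a: "u \<longlonglongrightarrow> a" unfolding Cauchy_convergent_iff convergent_def by blast
  have "(\<lambda>n. of_real c0 + \<i> * c1 * of_real (\<epsilon> n) + R n / of_real (\<epsilon> n) * of_real (\<epsilon> n))
      \<longlonglongrightarrow> of_real c0 + \<i> * c1 * of_real 0 + 0 * of_real 0"
    by (intro tendsto_intros \<epsilon>0 R)
  moreover have "of_real c0 + \<i> * c1 * of_real (\<epsilon> n) + R n / of_real (\<epsilon> n) * of_real (\<epsilon> n) = f n" for n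
    using \<epsilon>[of n] by (simp add: R_def)
  ultimately have f: "f \<longlonglongrightarrow> of_real c0" by simp
  have "(\<lambda>n. ((1, u n), (- f n, cscale (Complex x0 (\<epsilon> n)) (u n))))
      \<longlonglongrightarrow> ((1, a), (- of_real c0, cscale (Complex x0 0) a))"
    by (intro tendsto_intros a f \<epsilon>0)
  then have "((1, a), (- of_real c0, cscale (Complex x0 0) a)) \<in> T"
    by (rule T_closed[OF T u])
  then have "((1, a), (- of_real c0, x0 *\<^sub>R a)) \<in> T"
    by (simp flip: complex_of_real_def)
  then show thesis by (rule that)
qed

text \<open>With h \<epsilon> the value of G at the reciprocal of x0 + \<i> \<epsilon>, agreement
  with F above and with its reflection below gives h (- \<epsilon>) = cnj (h \<epsilon>). So h 0 is
  real and the derivative at 0 purely imaginary.\<close>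

lemma boundary_expansion:
  fixes F G :: "complex ^ 'd::finite \<Rightarrow> complex"
  assumes U: "open U" "(\<chi> r. of_real (1 / x0)) \<in> U" and x0: "x0 \<noteq> 0"
    and G: "G differentiable (at (\<chi> r. of_real (1 / x0)))"
    and up: "\<And>z. z \<in> U \<Longrightarrow> vec_inverse z \<in> poly_half_plane \<Longrightarrow> G z = F (vec_inverse z)"
    and low: "\<And>z. z \<in> U \<Longrightarrow> vec_cnj (vec_inverse z) \<in> poly_half_plane \<Longrightarrow>
      G z = cnj (F (vec_cnj (vec_inverse z)))"
  obtains c0 c1 :: real where "G (\<chi> r. of_real (1 / x0)) = of_real c0"
    and "((\<lambda>\<epsilon>. (F (\<chi> r. Complex x0 \<epsilon>) - c0 - \<i> * c1 * \<epsilon>) / of_real \<epsilon>) \<longlongrightarrow> 0) (at_right 0)"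
proof -
  define p :: "real \<Rightarrow> complex ^ 'd" where "p \<epsilon> = (\<chi> r. inverse (Complex x0 \<epsilon>))" for \<epsilon>
  define h where "h \<epsilon> = G (p \<epsilon>)" for \<epsilon>
  have p0: "p 0 = (\<chi> r. of_real (1 / x0))"
    by (simp add: p_def divide_inverse flip: complex_of_real_def)
  have "(\<lambda>\<epsilon>. inverse (of_real x0 + \<i> * of_real \<epsilon>) :: complex) differentiable (at (0::real))"
    using x0 by (intro differentiable_inverse derivative_intros
        bounded_linear_imp_differentiable[OF bounded_linear_of_real]) auto
  moreover have "bounded_linear (\<lambda>c :: complex. (\<chi> r. c) :: complex ^ 'd)"
    by (auto simp flip: linear_conv_bounded_linear intro!: linearI simp: vec_eq_iff)
  note differentiable_chain_at[OF calculation bounded_linear_imp_differentiable[OF this]]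
  then have "((\<lambda>c :: complex. (\<chi> r. c) :: complex ^ 'd) \<circ>
      (\<lambda>\<epsilon>. inverse (of_real x0 + \<i> * of_real \<epsilon>))) differentiable (at (0::real))"
    .
  then have p: "p differentiable (at 0)" by (simp add: p_def[abs_def] o_def Complex_eq)
  then have "(G \<circ> p) differentiable (at 0)"
    using G by (intro differentiable_chain_at) (simp_all add: p0)
  then obtain d where d: "(h has_vector_derivative d) (at 0)"
    by (auto simp: h_def[abs_def] o_def vector_derivative_works)
  define Q where "Q \<epsilon> = h \<epsilon> - h 0 - of_real \<epsilon> * d" for \<epsilon>
  have "((\<lambda>\<epsilon>. Q \<epsilon> / of_real \<bar>\<epsilon>\<bar>) \<longlongrightarrow> 0) (at 0)"
    using d unfolding has_vector_derivative_def has_derivative_def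
    by (simp add: Q_def scaleR_conv_of_real divide_inverse mult.commute diff_diff_eq)
  then have Qr': "((\<lambda>\<epsilon>. Q \<epsilon> / of_real \<bar>\<epsilon>\<bar>) \<longlongrightarrow> 0) (at_right 0)"
    and Ql': "((\<lambda>\<epsilon>. Q (- \<epsilon>) / of_real \<bar>- \<epsilon>\<bar>) \<longlongrightarrow> 0) (at_right 0)"
    by (simp_all add: filterlim_at_split filterlim_at_left_to_right)
  have pos: "\<forall>\<^sub>F \<epsilon> in at_right 0. \<epsilon> > (0::real)" by (rule eventually_at_right_less)
  have Qr: "((\<lambda>\<epsilon>. Q \<epsilon> / of_real \<epsilon>) \<longlongrightarrow> 0) (at_right 0)"
    by (rule Lim_transform_eventually[OF Qr']) (use pos in \<open>eventually_elim, simp\<close>)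
  have Ql: "((\<lambda>\<epsilon>. Q (- \<epsilon>) / of_real \<epsilon>) \<longlongrightarrow> 0) (at_right 0)"
    by (rule Lim_transform_eventually[OF Ql']) (use pos in \<open>eventually_elim, simp\<close>)
  have "isCont p 0" using p by (simp add: differentiable_imp_continuous_within)
  then have "\<forall>\<^sub>F \<epsilon> in at 0. p \<epsilon> \<in> U"
    using U p0 by (auto simp: isCont_def intro: topological_tendstoD)
  then have pU: "\<forall>\<^sub>F \<epsilon> in at_right 0. p \<epsilon> \<in> U" "\<forall>\<^sub>F \<epsilon> in at_right 0. p (- \<epsilon>) \<in> U"
    by (simp_all add: eventually_at_split eventually_at_left_to_right)
  have vi: "vec_inverse (p \<epsilon>) = (\<chi> r. Complex x0 \<epsilon>)" for \<epsilon>
    by (simp add: vec_inverse_def p_def vec_eq_iff divide_inverse)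
  have sym: "\<forall>\<^sub>F \<epsilon> in at_right 0. h \<epsilon> = F (\<chi> r. Complex x0 \<epsilon>) \<and> h (- \<epsilon>) = cnj (h \<epsilon>)"
    using pos pU
  proof eventually_elim
    case (elim \<epsilon>)
    have c: "vec_cnj (vec_inverse (p (- \<epsilon>))) = (\<chi> r. Complex x0 \<epsilon>)"
      by (simp add: vi vec_cnj_def vec_eq_iff complex_eq_iff)
    have "(\<chi> r. Complex x0 \<epsilon>) \<in> (poly_half_plane :: (complex ^ 'd) set)"
      using elim by (simp add: poly_half_plane_def upper_half_plane_def)
    then show ?case using up[OF elim(2)] low[OF elim(3), unfolded c] by (simp add: h_def vi)
  qed
  have "isCont h 0" using d has_vector_derivative_continuous by blast
  then have "(h \<longlongrightarrow> h 0) (at_right 0)" "((\<lambda>\<epsilon>. h (- \<epsilon>)) \<longlongrightarrow> h 0) (at_right 0)"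
    by (simp_all add: isCont_def filterlim_at_split filterlim_at_left_to_right)
  then have "((\<lambda>\<epsilon>. cnj (h \<epsilon>)) \<longlongrightarrow> cnj (h 0)) (at_right 0)" "((\<lambda>\<epsilon>. cnj (h \<epsilon>)) \<longlongrightarrow> h 0) (at_right 0)"
    by (auto intro: tendsto_cnj Lim_transform_eventually eventually_mono[OF sym])
  then have h0: "cnj (h 0) = h 0" by (rule tendsto_unique[OF trivial_limit_at_right_real])
  \<comment> \<open>By the reflection symmetry this quotient is the constant d + cnj d, which is
    therefore 0.\<close>
  have "((\<lambda>\<epsilon>. Q (- \<epsilon>) / of_real \<epsilon> - cnj (Q \<epsilon> / of_real \<epsilon>)) \<longlongrightarrow> 0 - cnj 0) (at_right 0)"
    by (intro tendsto_intros Qr Ql)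
  moreover have "\<forall>\<^sub>F \<epsilon> in at_right 0. Q (- \<epsilon>) / of_real \<epsilon> - cnj (Q \<epsilon> / of_real \<epsilon>) = d + cnj d"
    using sym pos by eventually_elim (simp add: Q_def h0 field_simps)
  ultimately have "((\<lambda>\<epsilon>. d + cnj d) \<longlongrightarrow> 0) (at_right (0::real))"
    by (auto intro: Lim_transform_eventually)
  then have "d + cnj d = 0" by (simp add: tendsto_const_iff)
  then have d': "d = \<i> * of_real (Im d)" by (simp add: complex_eq_iff)
  have h0': "h 0 = of_real (Re (h 0))" using h0 by (simp add: complex_eq_iff)
  show thesis
  proof
    show "G (\<chi> r. of_real (1 / x0)) = of_real (Re (h 0))" using h0' by (simp add: h_def p0)
    show "((\<lambda>\<epsilon>. (F (\<chi> r. Complex x0 \<epsilon>) - Re (h 0) - \<i> * Im d * \<epsilon>) / of_real \<epsilon>) \<longlongrightarrow> 0) (at_right 0)"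
    proof (rule Lim_transform_eventually[OF Qr])
      show "\<forall>\<^sub>F \<epsilon> in at_right 0. Q \<epsilon> / of_real \<epsilon>
          = (F (\<chi> r. Complex x0 \<epsilon>) - Re (h 0) - \<i> * Im d * \<epsilon>) / of_real \<epsilon>"
        using sym by eventually_elim (simp add: Q_def h0'[symmetric] d'[symmetric] mult.commute)
    qed
  qed
qed

section \<open>The transform by \<open>rho\<close> and the conclusion\<close>

lemma one_minus_mult_nonreal: "Im z > 0 \<Longrightarrow> 1 - of_real t * z \<noteq> 0"
  by (auto simp: complex_eq_iff)

text \<open>\<open>rho t\<close> is the Moebius map of a real matrix with determinant 1 +
  t^2.\<close>

lemma Im_rho_pos:
  assumes "Im z > 0"
  shows "Im (rho t z) > 0"
proof -
  have nz: "(1 - t * Re z)\<^sup>2 + (t * Im z)\<^sup>2 > 0"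
    using one_minus_mult_nonreal[OF assms, of t]
    by (simp add: complex_eq_iff sum_power2_gt_zero_iff)
  have "Im (rho t z) = (1 + t\<^sup>2) * Im z / ((1 - t * Re z)\<^sup>2 + (t * Im z)\<^sup>2)"
    unfolding rho_def Im_divide by (simp add: power2_eq_square algebra_simps)
  then show ?thesis using nz assms by (simp add: add_pos_nonneg)
qed

text \<open>Under \<open>rot (- t)\<close> the slope -F w becomes \<open>- rho t (F w)\<close>, and
  the slopes w r become \<open>rho (- t)\<close> of w r, that is z r when w r =
  \<open>rho t (z $ r)\<close>. So the pair of F at w becomes, up to a scalar, the pair of
  \<open>conj_rho t F\<close> at z, and the boundary pair at -1/t becomes the pair at
  infinity.\<close>

lemma (in projection_family) rotated_representation:
  fixes T :: "((complex \<times> 'm) \<times> (complex \<times> 'm)) set" and c0 t :: real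
  assumes T: "ann T = T"
    and F: "\<And>z. z \<in> poly_half_plane \<Longrightarrow> \<exists>u. ((1, u), (- F z, act z u)) \<in> T"
    and t: "t \<noteq> 0" "t * c0 \<noteq> 1"
    and u0: "((1, u0), (- of_real c0, (- 1 / t) *\<^sub>R u0)) \<in> T"
    and noneig: "\<And>y. (- t *\<^sub>R y, y) \<in> T \<Longrightarrow> y = 0"
  shows "has_resolvent_representation (conj_rho t F)"
proof -
  define S where "S = rot t -` T"
  have S: "ann S = S" unfolding S_def by (rule ann_rot[OF T])
  have S_cscale: "cscale c p \<in> S" if "p \<in> S" for c p
    using ann_cscale[of p S c] S that by simp
  have rotS: "rot (- t) p \<in> S" if "p \<in> T" for p
    using ann_scaleR[of p T "1 + t\<^sup>2"] T that by (simp add: S_def rot_rot)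
  define s where "s = 1 / (1 - t * c0)"
  \<comment> \<open>The vector entry u0 - t (1 / t) u0 of the rotated first component cancels;
    scaling by s makes its scalar entry 1, and C comes out as \<open>rho t\<close> of c0.\<close>
  have inf: "((1, 0), (- of_real ((c0 + t) * s), - ((s * (1 / t + t)) *\<^sub>R u0))) \<in> S"
  proof -
    have "rot (- t) ((1 :: complex, u0), (- of_real c0, (- 1 / t) *\<^sub>R u0))
        = ((of_real (1 - t * c0), 0), (- of_real (c0 + t), - ((1 / t + t) *\<^sub>R u0)))"
      using t by (simp add: rot_def scaleR_conv_of_real algebra_simps)
    moreover have "cscale (of_real s) \<dots> = ((of_real (s * (1 - t * c0)), 0),
        (- of_real ((c0 + t) * s), - ((s * (1 / t + t)) *\<^sub>R u0)))"
      by (simp only: cscale_Pair cscale_simps scaleR_scaleR scaleR_conv_of_real[where 'a = complex]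
          of_real_mult mult.commute[of s "c0 + t"] mult_minus_right mult.commute[of "of_real s" "of_real (c0 + t)"])
    moreover have "s * (1 - t * c0) = 1" using t by (simp add: s_def)
    ultimately show ?thesis using S_cscale[OF rotS[OF u0], of "of_real s"] by simp
  qed
  show ?thesis
  proof (rule representation_of_self_adjoint_relation[OF S inf])
    fix k assume "(0, k) \<in> S"
    then show "k = 0" by (intro noneig) (simp add: S_def rot_def)
  next
    fix z :: "complex ^ 'd" assume z: "z \<in> poly_half_plane"
    define w where "w = (\<chi> r. rho t (z $ r))"
    have zr: "Im (z $ r) > 0" for r
      using z by (simp add: poly_half_plane_def upper_half_plane_def)
    have w: "w \<in> poly_half_plane"
      by (simp add: w_def poly_half_plane_def upper_half_plane_def Im_rho_pos zr)
    obtain u where u: "((1, u), (- F w, act w u)) \<in> T" using F[OF w] by blast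
    \<comment> \<open>Otherwise F w would be the real number 1 / t and coercivity would force u = 0;
      the remaining pair tested against that of u0 gives c0 = 1 / t.\<close>
    have nz: "1 - t * F w \<noteq> 0"
    proof
      assume "1 - t * F w = 0"
      then have Fw: "F w = of_real (1 / t)" using t by (simp add: field_simps)
      obtain m where m: "m > 0" "\<And>r. m \<le> Im (w $ r)"
        using poly_half_plane_lower_bound[OF w] by blast
      have "Im (cip (act w u) u) = 0"
        using ann_sform[OF T u u] cip_commute[of u "act w u"]
        by (auto simp: sform_def cip_Pair Fw complex_eq_iff)
      then have "u = 0" using Im_cip_act_ge[OF m(2), of u] m(1) by (simp add: mult_le_0_iff)
      with u have "((1, 0), (- of_real (1 / t), 0)) \<in> T" by (simp add: Fw act_0)
      from ann_sform[OF T this u0] have "of_real c0 = complex_of_real (1 / t)"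
        by (simp add: sform_def cip_Pair)
      then have "c0 = 1 / t" by (simp only: of_real_eq_iff)
      then show False using t by simp
    qed
    \<comment> \<open>The equation w = \<open>rho t z\<close>, cleared of its denominator
      coordinatewise, is z + t z w = w - t; multiplicativity of \<open>act\<close> carries it
      over.\<close>
    have key: "act z (u + t *\<^sub>R act w u) = act w u - t *\<^sub>R u"
    proof -
      have "z $ r + of_real t * (z $ r * w $ r) = w $ r - of_real t" for r
        using one_minus_mult_nonreal[OF zr, of t r] by (simp add: w_def rho_def field_simps)
      then have "z + (\<chi> r. of_real t) * (\<chi> r. z $ r * w $ r) = w - (\<chi> r. of_real t)"
        by (simp add: vec_eq_iff)
      then have "act z u + act ((\<chi> r. of_real t) * (\<chi> r. z $ r * w $ r)) u
          = act w u - act (\<chi> r. of_real t) u"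
        by (simp flip: act_add_left act_diff_left)
      moreover have "act ((\<chi> r. of_real t) * (\<chi> r. z $ r * w $ r)) u
          = act (\<chi> r. of_real t) (act (\<chi> r. z $ r * w $ r) u)"
        by (simp only: act_act times_vec_def vec_lambda_beta)
      moreover have "\<dots> = t *\<^sub>R act z (act w u)"
        by (simp only: act_const cscale_simps) (simp only: act_act)
      ultimately show ?thesis
        using act_cscale[of z "of_real t" "act w u"] by (simp add: act_add act_const act_act)
    qed
    define \<sigma> where "\<sigma> = 1 / (1 - t * F w)"
    have "rot (- t) ((1, u), (- F w, act w u))
        = ((1 - t * F w, u + t *\<^sub>R act w u), (- (F w + t), act w u - t *\<^sub>R u))"
      by (simp add: rot_def scaleR_conv_of_real)
    moreover have "conj_rho t F z = (F w + t) * \<sigma>"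
      unfolding conj_rho_def w_def[symmetric] by (simp add: rho_def \<sigma>_def)
    ultimately have "((1, cscale \<sigma> (u + t *\<^sub>R act w u)), (- conj_rho t F z, act z (cscale \<sigma> (u + t *\<^sub>R act w u)))) \<in> S"
      using S_cscale[OF rotS[OF u], of \<sigma>] nz
      by (simp add: cscale_Pair \<sigma>_def act_cscale key mult.commute minus_divide_left)
    then show "\<exists>u. ((1, u), (- conj_rho t F z, act z u)) \<in> S" by blast
  qed
qed

theorem theorem1p22:
  fixes F :: "complex ^ 'd \<Rightarrow> complex"
  assumes "F \<in> loewner_class"
    and "analytic_at_infinity F"
  shows "\<exists>\<epsilon>>0. \<exists>E. countable E \<and>
    (\<forall>t::real. \<bar>t\<bar> < \<epsilon> \<and> t \<notin> E \<longrightarrow> has_resolvent_representation (conj_rho t F))"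
proof -
  obtain U and G :: "complex ^ 'd \<Rightarrow> complex" where U: "0 \<in> U" and G: "G several_analytic_on U"
    and up: "\<And>z. z \<in> U \<Longrightarrow> vec_inverse z \<in> poly_half_plane \<Longrightarrow> G z = F (vec_inverse z)"
    and low: "\<And>z. z \<in> U \<Longrightarrow> vec_cnj (vec_inverse z) \<in> poly_half_plane \<Longrightarrow>
      G z = cnj (F (vec_cnj (vec_inverse z)))"
    using assms(2) unfolding analytic_at_infinity_def by blast
  have "open U" and diff: "\<And>z. z \<in> U \<Longrightarrow> G differentiable (at z)"
    using G by (auto simp: several_analytic_on_def differentiable_def)
  obtain T :: "((complex \<times> 'd model) \<times> (complex \<times> 'd model)) set"
    where T: "ann T = T"
      and F: "\<And>z. z \<in> poly_half_plane \<Longrightarrow> \<exists>u. ((1, u), (- F z, model.act z u)) \<in> T"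
    using loewner_relation[OF assms(1)] by blast
  \<comment> \<open>The reciprocal of the diagonal point -1/t; it tends to the origin with t and so
    enters U.\<close>
  define p :: "real \<Rightarrow> complex ^ 'd" where "p t = (\<chi> r. of_real (- t))" for t
  have p0: "(p \<longlongrightarrow> 0) (at 0)"
    unfolding p_def by (rule vec_tendstoI) (auto intro!: tendsto_eq_intros)
  have "isCont G 0" using diff[OF U] by (rule differentiable_imp_continuous_within)
  \<comment> \<open>This keeps t c0 away from 1, so that \<open>rho t\<close> is finite at the
    boundary value c0 = G (p t).\<close>
  then have "((\<lambda>t. t * G (p t)) \<longlongrightarrow> of_real 0 * G 0) (at 0)"
    by (intro tendsto_intros isCont_tendsto_compose[OF _ p0])
  then have "\<forall>\<^sub>F t in at 0. dist (t * G (p t)) 0 < 1" by (intro tendstoD) simp_all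
  moreover have "\<forall>\<^sub>F t in at 0. p t \<in> U" using topological_tendstoD[OF p0 \<open>open U\<close> U] .
  ultimately have "\<forall>\<^sub>F t in at 0. p t \<in> U \<and> cmod (t * G (p t)) < 1"
    by eventually_elim simp
  then obtain \<epsilon> where "\<epsilon> > 0"
    and \<epsilon>: "\<And>t. t \<noteq> 0 \<Longrightarrow> \<bar>t\<bar> < \<epsilon> \<Longrightarrow> p t \<in> U \<and> cmod (t * G (p t)) < 1"
    by (auto simp: eventually_at)
  \<comment> \<open>0 is excepted because the argument uses the point -1/t; the other exceptions are
    the t for which the rotated relation is multivalued.\<close>
  define E where "E = insert 0 {t. \<exists>y. y \<noteq> 0 \<and> (- t *\<^sub>R y, y) \<in> T}"
  have "countable E" unfolding E_def using countable_eigenvalues[OF T] by simp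
  moreover have "has_resolvent_representation (conj_rho t F)" if t: "\<bar>t\<bar> < \<epsilon>" "t \<notin> E" for t
  proof -
    have t0: "t \<noteq> 0" and noneig: "\<And>y. (- t *\<^sub>R y, y) \<in> T \<Longrightarrow> y = 0"
      using t(2) unfolding E_def by blast+
    have pt: "p t = (\<chi> r. of_real (1 / (- 1 / t)))" by (simp add: p_def)
    obtain c0 c1 where c0: "G (p t) = of_real c0"
      and lim: "((\<lambda>\<epsilon>. (F (\<chi> r. Complex (- 1 / t) \<epsilon>) - of_real c0 - \<i> * of_real c1 * of_real \<epsilon>)
        / of_real \<epsilon>) \<longlongrightarrow> 0) (at_right 0)"
      using boundary_expansion[OF \<open>open U\<close> _ _ _ up low, of "- 1 / t"] \<epsilon>[OF t0 t(1)] diff t0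
      unfolding pt[symmetric] by auto
    obtain u0 where u0: "((1, u0), (- of_real c0, (- 1 / t) *\<^sub>R u0)) \<in> T"
      using model.boundary_vector[OF T F lim] by blast
    have "\<bar>t * c0\<bar> < 1" using \<epsilon>[OF t0 t(1)] by (simp add: c0 norm_mult abs_mult)
    then have "t * c0 \<noteq> 1" by auto
    show ?thesis
      by (rule model.rotated_representation[OF T _ t0 \<open>t * c0 \<noteq> 1\<close> u0]) (use F noneig in blast)+
  qed
  ultimately show ?thesis using \<open>\<epsilon> > 0\<close> by blast
qed

end
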